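(* Let $\varphi\in(0,1)$ with $\varphi=\Omega(1)$ and $d=O(1)$. Let $X$ be a uniformly random bit. If $X=0$, the input is a $d$-regular $\varphi$-expander on $2n$ vertices. If $X=1$, pair the vertices as $\{1,2\},\{3,4\},\dots,\{2n-1,2n\}$, for each pair $\{2i-1,2i\}$ pick an independent uniformly random $Y_i\in\{\pm1\}$, put $2i-1$ in set 1 and $2i$ in set 2 if $Y_i=1$ and the reverse otherwise, and the input is a $d$-regular graph consisting of two identical $\varphi$-expanders on set 1 and on set 2. Let $\mathcal A$ be an algorithm that accesses the graph only through $T$ random walk queries, uses $M$ bits of space, and determines $X$ with error probability at most $1/3$. Then $M\cdot T=\Omega(n)$.
   Context: The conductance of $G$ is $\phi(G)=\min_{C\subseteq V,\,0<\mathrm{vol}(C)\le\mathrm{vol}(V)/2}|E(C,V\setminus C)|/\mathrm{vol}(C)$ with $\mathrm{vol}(C)=\sum_{v\in C}d_v$; $G$ is a $\varphi$-expander if $\phi(G)\ge\varphi$. A random walk query, for a specified starting vertex $x$, returns the endpoint of an $O(\log n)$-step lazy random walk from $x$ (at each step the walk stays put with probability $1/2$ and otherwise moves to a uniformly random neighbor).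
   Formalization: The O(log n)-step walk is taken to have length at least C₀ ln n for a sufficiently large constant C₀ depending on the lower bound for φ (long enough to mix); for very short walks, e.g. one step, the claim fails. *)

theory Defs
  imports "HOL-Probability.Probability" "HOL-Probability.Product_PMF" "Graph_Theory.Graph_Theory"
begin

section \<open>Expanders\<close>

text \<open>
  Finite simple undirected graphs are the \<^locale>\<open>pair_graph\<close>s of the library: every edge is
  represented by its two arcs, so the out-degree of a vertex is its degree, and the arcs
  leaving \<open>C\<close> are in bijection with the edges in \<open>E(C, V - C)\<close>.
\<close>

definition regular_graph :: "nat \<Rightarrow> 'a pair_pre_digraph \<Rightarrow> bool" where
  "regular_graph d G \<longleftrightarrow> pair_graph G \<and> (\<forall>v\<in>pverts G. out_degree (with_proj G) v = d)"

definition vol :: "'a pair_pre_digraph \<Rightarrow> 'a set \<Rightarrow> nat" where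
  "vol G C = (\<Sum>v\<in>C. out_degree (with_proj G) v)"

definition cut_size :: "'a pair_pre_digraph \<Rightarrow> 'a set \<Rightarrow> nat" where
  "cut_size G C = card {(u, v) \<in> parcs G. u \<in> C \<and> v \<in> pverts G - C}"

definition conductance :: "'a pair_pre_digraph \<Rightarrow> real" where
  "conductance G =
     Min {real (cut_size G C) / real (vol G C) | C.
            C \<subseteq> pverts G \<and> 0 < vol G C \<and> real (vol G C) \<le> real (vol G (pverts G)) / 2}"

definition expander :: "real \<Rightarrow> 'a pair_pre_digraph \<Rightarrow> bool" where
  "expander \<phi> G \<longleftrightarrow> conductance G \<ge> \<phi>"

section \<open>Random walk queries\<close>

definition lazy_step :: "'a pair_pre_digraph \<Rightarrow> 'a \<Rightarrow> 'a pmf" where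
  "lazy_step G v =
     bernoulli_pmf (1/2) \<bind> (\<lambda>stay.
       if stay then return_pmf v else pmf_of_set {w. (v, w) \<in> parcs G})"

primrec lazy_walk :: "'a pair_pre_digraph \<Rightarrow> nat \<Rightarrow> 'a \<Rightarrow> 'a pmf" where
  "lazy_walk G 0 x = return_pmf x"
| "lazy_walk G (Suc l) x = lazy_walk G l x \<bind> lazy_step G"

section \<open>Space-bounded query algorithms\<close>

text \<open>
  Between two queries a program remembers only its memory contents, a bit string.  In round
  \<open>t\<close> with memory \<open>s\<close> it queries the vertex \<open>query P t s\<close>, and on the answer \<open>y\<close> its memory
  becomes \<open>update P t s y\<close>; after the last round it outputs \<open>verdict P s\<close>.  The round number
  is available without being stored, and computation within a round is not charged for.  A
  randomized algorithm is a probability distribution over programs, so that its random coins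
  are not charged for either.
\<close>

record rw_program =
  start :: "bool list"
  query :: "nat \<Rightarrow> bool list \<Rightarrow> nat"
  update :: "nat \<Rightarrow> bool list \<Rightarrow> nat \<Rightarrow> bool list"
  verdict :: "bool list \<Rightarrow> bool"

definition uses_space :: "rw_program \<Rightarrow> nat \<Rightarrow> bool" where
  "uses_space P M \<longleftrightarrow>
     length (start P) = M \<and> (\<forall>t s y. length s = M \<longrightarrow> length (update P t s y) = M)"

definition queries_within :: "rw_program \<Rightarrow> nat \<Rightarrow> nat set \<Rightarrow> bool" where
  "queries_within P M V \<longleftrightarrow> (\<forall>t s. length s = M \<longrightarrow> query P t s \<in> V)"

text \<open>Distribution of the memory contents after \<open>T\<close> queries answered by walks of length \<open>l\<close>.\<close>

primrec memory_after :: "nat pair_pre_digraph \<Rightarrow> nat \<Rightarrow> rw_program \<Rightarrow> nat \<Rightarrow> bool list pmf" where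
  "memory_after G l P 0 = return_pmf (start P)"
| "memory_after G l P (Suc T) =
     memory_after G l P T \<bind> (\<lambda>s. map_pmf (update P T s) (lazy_walk G l (query P T s)))"

section \<open>The input distribution\<close>

definition random_signs :: "nat \<Rightarrow> (nat \<Rightarrow> int) pmf" where
  "random_signs n = Pi_pmf {1..n} 1 (\<lambda>_. pmf_of_set {-1, 1})"

definition set1 :: "nat \<Rightarrow> (nat \<Rightarrow> int) \<Rightarrow> nat set" where
  "set1 n Y = (\<lambda>i. if Y i = 1 then 2 * i - 1 else 2 * i) ` {1..n}"

definition set2 :: "nat \<Rightarrow> (nat \<Rightarrow> int) \<Rightarrow> nat set" where
  "set2 n Y = (\<lambda>i. if Y i = 1 then 2 * i else 2 * i - 1) ` {1..n}"

text \<open>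
  Identical means isomorphic; copying one graph along the index \<open>i\<close> of the pairs is a special
  case.
\<close>

definition two_identical_expanders ::
    "real \<Rightarrow> nat set \<Rightarrow> nat set \<Rightarrow> nat pair_pre_digraph \<Rightarrow> bool" where
  "two_identical_expanders \<phi> S1 S2 G \<longleftrightarrow>
     (\<exists>H1 H2. pair_graph H1 \<and> pair_graph H2 \<and> pverts H1 = S1 \<and> pverts H2 = S2 \<and>
        expander \<phi> H1 \<and> expander \<phi> H2 \<and> digraph_iso (with_proj H1) (with_proj H2) \<and>
        pverts G = S1 \<union> S2 \<and> parcs G = parcs H1 \<union> parcs H2)"

text \<open>
  \<open>G0\<close> is the input for \<open>X = 0\<close> and \<open>G1 Y\<close> the input for \<open>X = 1\<close> and signs \<open>Y\<close>; the bit \<open>X\<close> is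
  a truth value, with \<open>True\<close> for 1.
\<close>

definition input_graph ::
    "nat \<Rightarrow> nat pair_pre_digraph \<Rightarrow> ((nat \<Rightarrow> int) \<Rightarrow> nat pair_pre_digraph) \<Rightarrow>
     bool \<Rightarrow> nat pair_pre_digraph pmf" where
  "input_graph n G0 G1 X = (if X then map_pmf G1 (random_signs n) else return_pmf G0)"

definition error_prob ::
    "nat \<Rightarrow> nat pair_pre_digraph \<Rightarrow> ((nat \<Rightarrow> int) \<Rightarrow> nat pair_pre_digraph) \<Rightarrow>
     nat \<Rightarrow> rw_program pmf \<Rightarrow> nat \<Rightarrow> real" where
  "error_prob n G0 G1 l \<A> T =
     measure_pmf.prob
       (pmf_of_set (UNIV :: bool set) \<bind> (\<lambda>X.
        input_graph n G0 G1 X \<bind> (\<lambda>G.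
        \<A> \<bind> (\<lambda>P.
        map_pmf (\<lambda>s. (X, verdict P s)) (memory_after G l P T)))))
       {(X, guess). guess \<noteq> X}"

end

theory Submission
  imports Defs
begin

text \<open>
  By Cheeger's inequality, a lazy walk of length at least \<open>16 ln n / \<phi>\<^sub>0\<^sup>2\<close> ends within distance
  \<open>O(1 / n)\<close> of the uniform distribution on its connected component, so over \<open>T \<le> n / 1000\<close>
  queries the answers may be taken to be exactly uniform on the component.

  For \<open>X = 0\<close> such an answer carries no information.  For \<open>X = 1\<close>, a query in pair \<open>i\<close> reveals a
  uniformly random pair \<open>j\<close> together with the product \<open>Y\<^sub>i Y\<^sub>j\<close>.  Conditioned on a memory state of
  probability \<open>p\<close>, the squared biases of these products add up to \<open>O(1 + ln (1 / p))\<close>, by the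
  level-one inequality on the cube, so the answer has relative entropy \<open>O((1 + ln (1 / p)) / n)\<close>
  to the uniform distribution.  The average of \<open>ln (1 / p)\<close> over the states is at most the entropy
  bound \<open>M ln 2\<close>, and by the chain rule the memory contents for \<open>X = 1\<close> and \<open>X = 0\<close> differ by
  \<open>O(M T / n)\<close> in relative entropy after \<open>T\<close> queries.

  Relative entropy is used only in its dual (Donsker--Varadhan) form \<open>E\<^sub>1 ln F \<le> ln E\<^sub>0 F + \<dots>\<close>,
  which is stable under the induction on \<open>T\<close> and needs no absolute continuity.
\<close>

section \<open>Mixing of the lazy walk\<close>

text \<open>Serves both inputs: \<open>V\<close> is the whole vertex set for \<open>X = 0\<close>
  and one of the two sides for \<open>X = 1\<close>. Regularity turns volumes into cardinalities, so
  \<open>expansion\<close> is the conductance bound multiplied out.\<close>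

locale regular_expander_component =
  fixes G :: "'a pair_pre_digraph" and V :: "'a set" and d :: nat and \<phi> :: real
  assumes finite_V: "finite V"
    and V_nonempty: "V \<noteq> {}"
    and d_pos: "0 < d"
    and \<phi>_pos: "0 < \<phi>"
    and arcs_sym: "(u, v) \<in> parcs G \<Longrightarrow> (v, u) \<in> parcs G"
    and arcs_closed: "u \<in> V \<Longrightarrow> (u, v) \<in> parcs G \<Longrightarrow> v \<in> V"
    and card_neighbours: "u \<in> V \<Longrightarrow> card {v. (u, v) \<in> parcs G} = d"
    and expansion: "C \<subseteq> V \<Longrightarrow> C \<noteq> {} \<Longrightarrow> 2 * card C \<le> card V \<Longrightarrow>
      \<phi> * d * card C \<le> card {(u, v) \<in> parcs G. u \<in> C \<and> v \<in> V - C}"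
begin

section \<open>Sums over arcs and Cheeger's inequality\<close>

definition adj :: "'a \<Rightarrow> 'a \<Rightarrow> real" where
  "adj u v = of_bool ((u, v) \<in> parcs G)"

lemma adj_nonneg: "0 \<le> adj u v"
  by (simp add: adj_def)

lemma adj_commute: "adj u v = adj v u"
  using arcs_sym by (auto simp: adj_def)

lemma sum_adj: "u \<in> V \<Longrightarrow> (\<Sum>v\<in>V. adj u v) = d"
proof -
  assume u: "u \<in> V"
  then have "{v. (u, v) \<in> parcs G} = V \<inter> {v. (u, v) \<in> parcs G}"
    using arcs_closed by auto
  then show ?thesis
    using card_neighbours[OF u] finite_V by (simp add: adj_def of_bool_def sum.If_cases)
qed

lemma sum_adj_left:
  fixes g :: "'a \<Rightarrow> real"
  shows "(\<Sum>u\<in>V. \<Sum>v\<in>V. adj u v * g u) = d * (\<Sum>u\<in>V. g u)"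
  by (simp add: sum_distrib_right[symmetric] sum_adj sum_distrib_left)

lemma sum_adj_swap: "(\<Sum>u\<in>V. \<Sum>v\<in>V. adj u v * F u v) = (\<Sum>u\<in>V. \<Sum>v\<in>V. adj u v * F v u)"
  by (subst sum.swap) (simp add: adj_commute)

lemma sum_adj_right:
  fixes g :: "'a \<Rightarrow> real"
  shows "(\<Sum>u\<in>V. \<Sum>v\<in>V. adj u v * g v) = d * (\<Sum>u\<in>V. g u)"
  by (subst sum_adj_swap) (rule sum_adj_left)

lemma sum_adj_cut:
  assumes "C \<subseteq> V"
  shows "(\<Sum>u\<in>V. \<Sum>v\<in>V. adj u v * of_bool (u \<in> C \<and> v \<notin> C))
    = card {(u, v) \<in> parcs G. u \<in> C \<and> v \<in> V - C}"
proof -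
  have "(\<Sum>u\<in>V. \<Sum>v\<in>V. adj u v * of_bool (u \<in> C \<and> v \<notin> C))
    = (\<Sum>x\<in>V \<times> V. of_bool (x \<in> {(u, v) \<in> parcs G. u \<in> C \<and> v \<in> V - C}))"
    unfolding sum.cartesian_product by (rule sum.cong) (auto simp: adj_def)
  also have "\<dots> = card ((V \<times> V) \<inter> {(u, v) \<in> parcs G. u \<in> C \<and> v \<in> V - C})"
    using finite_V by (simp add: of_bool_def sum.If_cases del: mem_Collect_eq)
  also have "(V \<times> V) \<inter> {(u, v) \<in> parcs G. u \<in> C \<and> v \<in> V - C}
    = {(u, v) \<in> parcs G. u \<in> C \<and> v \<in> V - C}"
    using assms by auto
  finally show ?thesis .
qed

text \<open>Peeling off the lowest positive level of \<open>h\<close> is a discrete co-area formula.\<close>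

lemma coarea_bound:
  fixes h :: "'a \<Rightarrow> real"
  assumes "\<And>v. v \<in> V \<Longrightarrow> 0 \<le> h v" "2 * card {v\<in>V. 0 < h v} \<le> card V"
  shows "\<phi> * d * (\<Sum>v\<in>V. h v) \<le> (\<Sum>u\<in>V. \<Sum>v\<in>V. adj u v * max 0 (h u - h v))"
  using assms
proof (induction "card {v\<in>V. 0 < h v}" arbitrary: h rule: less_induct)
  case less
  define S where "S = {v\<in>V. 0 < h v}"
  have finS: "finite S" and SV: "S \<subseteq> V" using finite_V by (auto simp: S_def)
  show ?case
  proof (cases "S = {}")
    case True
    then have "h v = 0" if "v \<in> V" for v
      using less.prems(1)[OF that] that by (force simp: S_def)
    then show ?thesis by simp
  next
    case False
    define m where "m = Min (h ` S)"
    have m_le: "m \<le> h v" if "v \<in> S" for v using that finS by (simp add: m_def)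
    have "m \<in> h ` S" unfolding m_def using finS False by (intro Min_in) auto
    then obtain w where w: "w \<in> S" "h w = m" by auto
    have m_pos: "0 < m" using w by (auto simp: S_def)
    define h' where "h' v = h v - m * of_bool (v \<in> S)" for v
    have h'_nonneg: "0 \<le> h' v" if "v \<in> V" for v
      using less.prems(1)[OF that] m_le by (auto simp: h'_def)
    have outside: "h v = 0" if "v \<in> V" "v \<notin> S" for v
      using less.prems(1)[of v] that by (force simp: S_def)
    have sub: "{v\<in>V. 0 < h' v} \<subseteq> S - {w}"
      using w by (auto simp: h'_def S_def of_bool_def split: if_splits)
    have card_less: "card {v\<in>V. 0 < h' v} < card S"
      using card_mono[OF _ sub] finS card_Diff1_less[OF finS w(1)] by simp
    have cardS: "2 * card S \<le> card V" using less.prems(2) by (simp add: S_def)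
    have IH: "\<phi> * d * (\<Sum>v\<in>V. h' v) \<le> (\<Sum>u\<in>V. \<Sum>v\<in>V. adj u v * max 0 (h' u - h' v))"
      using less.hyps[of h', folded S_def, OF card_less h'_nonneg] card_less cardS by simp
    have "(\<Sum>u\<in>V. \<Sum>v\<in>V. adj u v * max 0 (h u - h v))
      = (\<Sum>u\<in>V. \<Sum>v\<in>V. adj u v * max 0 (h' u - h' v) + m * (adj u v * of_bool (u \<in> S \<and> v \<notin> S)))"
    proof (intro sum.cong refl)
      fix u v assume uv: "u \<in> V" "v \<in> V"
      \<comment> \<open>Lowering all of \<open>S\<close> by \<open>m\<close> cancels on arcs inside
        \<open>S\<close>; only arcs leaving \<open>S\<close> lose, and they lose exactly
        \<open>m\<close>, because \<open>h\<close> vanishes on the rest of \<open>V\<close>.\<close>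
      have "max 0 (h u - h v) = max 0 (h' u - h' v) + m * of_bool (u \<in> S \<and> v \<notin> S)"
        using uv outside[of u] outside[of v] m_le[of u] m_le[of v] m_pos
        by (cases "u \<in> S"; cases "v \<in> S") (auto simp: h'_def max_def)
      then show "adj u v * max 0 (h u - h v)
        = adj u v * max 0 (h' u - h' v) + m * (adj u v * of_bool (u \<in> S \<and> v \<notin> S))"
        by (simp add: algebra_simps)
    qed
    also have "\<dots> = (\<Sum>u\<in>V. \<Sum>v\<in>V. adj u v * max 0 (h' u - h' v))
        + m * card {(u, v) \<in> parcs G. u \<in> S \<and> v \<in> V - S}"
      by (simp only: sum.distrib sum_distrib_left[symmetric] sum_adj_cut[OF SV])
    also have "\<dots> \<ge> \<phi> * d * (\<Sum>v\<in>V. h' v) + m * (\<phi> * d * card S)"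
      using IH expansion[OF SV False cardS] m_pos by (intro add_mono mult_left_mono) auto
    also have "\<phi> * d * (\<Sum>v\<in>V. h' v) + m * (\<phi> * d * card S) = \<phi> * d * (\<Sum>v\<in>V. h v)"
    proof -
      have "(\<Sum>v\<in>V. m * of_bool (v \<in> S)) = m * card S"
        using finite_V SV by (simp add: of_bool_def sum_distrib_left[symmetric] sum.If_cases Int_absorb1)
      then show ?thesis by (simp add: h'_def sum_subtractf algebra_simps)
    qed
    finally show ?thesis .
  qed
qed

text \<open>Apply the co-area bound to \<open>g\<^sup>2\<close>. Factoring the differences of
  squares, AM-GM with weight \<open>\<phi> / 2\<close> on \<open>g u + g v\<close> costs
  \<open>\<phi>\<^sup>2 * d * ?N\<close>, half of the co-area lower bound for
  \<open>2 * (\<phi> * ?A)\<close>, so it can be absorbed.\<close>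

lemma dirichlet_form_bound_nonneg:
  fixes g :: "'a \<Rightarrow> real"
  assumes g: "\<And>v. v \<in> V \<Longrightarrow> 0 \<le> g v" and small: "2 * card {v\<in>V. 0 < g v} \<le> card V"
  shows "\<phi>\<^sup>2 * d * (\<Sum>v\<in>V. (g v)\<^sup>2) \<le> (\<Sum>u\<in>V. \<Sum>v\<in>V. adj u v * (g u - g v)\<^sup>2)"
proof -
  let ?A = "\<Sum>u\<in>V. \<Sum>v\<in>V. adj u v * max 0 ((g u)\<^sup>2 - (g v)\<^sup>2)"
  let ?B = "\<Sum>u\<in>V. \<Sum>v\<in>V. adj u v * (g u - g v)\<^sup>2"
  let ?N = "\<Sum>v\<in>V. (g v)\<^sup>2"
  have "{v\<in>V. 0 < (g v)\<^sup>2} = {v\<in>V. 0 < g v}" using g by force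
  then have A: "\<phi> * d * ?N \<le> ?A"
    using coarea_bound[of "\<lambda>v. (g v)\<^sup>2"] small by simp
  \<comment> \<open>Exchanging \<open>u\<close> and \<open>v\<close> in one of two copies of
    \<open>?A\<close> turns the positive parts into absolute values.\<close>
  have "2 * (\<phi> * ?A) = (\<Sum>u\<in>V. \<Sum>v\<in>V. adj u v * (\<phi> * max 0 ((g u)\<^sup>2 - (g v)\<^sup>2)))
     + (\<Sum>u\<in>V. \<Sum>v\<in>V. adj u v * (\<phi> * max 0 ((g v)\<^sup>2 - (g u)\<^sup>2)))"
    by (subst (2) sum_adj_swap) (simp add: sum_distrib_left algebra_simps)
  also have "\<dots> = (\<Sum>u\<in>V. \<Sum>v\<in>V. adj u v * (\<phi> * \<bar>(g u)\<^sup>2 - (g v)\<^sup>2\<bar>))"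
    unfolding sum.distrib[symmetric] distrib_left[symmetric]
    by (intro sum.cong refl) (simp add: max_def)
  also have "\<dots> \<le> (\<Sum>u\<in>V. \<Sum>v\<in>V. adj u v * (g u - g v)\<^sup>2
      + (adj u v * (\<phi>\<^sup>2 / 2 * (g u)\<^sup>2) + adj u v * (\<phi>\<^sup>2 / 2 * (g v)\<^sup>2)))"
  proof (intro sum_mono)
    fix u v assume "u \<in> V" "v \<in> V"
    have am_gm: "2 * a * b \<le> a\<^sup>2 + b\<^sup>2" for a b :: real
      using sum_squares_bound[of a b] by simp
    have "\<bar>(g u)\<^sup>2 - (g v)\<^sup>2\<bar> = \<bar>g u - g v\<bar> * \<bar>g u + g v\<bar>"
      by (simp add: power2_eq_square square_diff_square_factored abs_mult)
    then have "\<phi> * \<bar>(g u)\<^sup>2 - (g v)\<^sup>2\<bar> = 2 * \<bar>g u - g v\<bar> * (\<phi> / 2 * \<bar>g u + g v\<bar>)"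
      by simp
    also have "\<dots> \<le> (g u - g v)\<^sup>2 + \<phi>\<^sup>2 / 4 * (g u + g v)\<^sup>2"
      using am_gm[of "\<bar>g u - g v\<bar>" "\<phi> / 2 * \<bar>g u + g v\<bar>"] by (simp add: power_mult_distrib power_divide)
    also have "\<phi>\<^sup>2 / 4 * (g u + g v)\<^sup>2 \<le> \<phi>\<^sup>2 / 4 * (2 * (g u)\<^sup>2 + 2 * (g v)\<^sup>2)"
      using am_gm[of "g u" "g v"] by (intro mult_left_mono) (auto simp: power2_sum)
    finally have "\<phi> * \<bar>(g u)\<^sup>2 - (g v)\<^sup>2\<bar>
      \<le> (g u - g v)\<^sup>2 + (\<phi>\<^sup>2 / 2 * (g u)\<^sup>2 + \<phi>\<^sup>2 / 2 * (g v)\<^sup>2)"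
      by (simp add: algebra_simps)
    then have "adj u v * (\<phi> * \<bar>(g u)\<^sup>2 - (g v)\<^sup>2\<bar>)
      \<le> adj u v * ((g u - g v)\<^sup>2 + (\<phi>\<^sup>2 / 2 * (g u)\<^sup>2 + \<phi>\<^sup>2 / 2 * (g v)\<^sup>2))"
      by (intro mult_left_mono adj_nonneg)
    then show "adj u v * (\<phi> * \<bar>(g u)\<^sup>2 - (g v)\<^sup>2\<bar>) \<le> adj u v * (g u - g v)\<^sup>2
      + (adj u v * (\<phi>\<^sup>2 / 2 * (g u)\<^sup>2) + adj u v * (\<phi>\<^sup>2 / 2 * (g v)\<^sup>2))"
      by (simp add: algebra_simps)
  qed
  also have "\<dots> = ?B + \<phi>\<^sup>2 * d * ?N"
    by (simp only: sum.distrib sum_adj_left sum_adj_right sum_distrib_left[symmetric]) simp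
  finally have "2 * (\<phi> * ?A) \<le> ?B + \<phi>\<^sup>2 * d * ?N" .
  moreover have "\<phi> * (\<phi> * d * ?N) \<le> \<phi> * ?A"
    using A \<phi>_pos by (intro mult_left_mono) auto
  ultimately show ?thesis by (simp add: power2_eq_square mult.assoc)
qed

text \<open>The least value \<open>m\<close> of \<open>f\<close> with at most half of
  \<open>V\<close> above it works: the largest value below \<open>m\<close> has more than half of
  \<open>V\<close> above it, so fewer than half lie below \<open>m\<close>.\<close>

lemma exists_median:
  fixes f :: "'a \<Rightarrow> real"
  shows "\<exists>m. 2 * card {v\<in>V. m < f v} \<le> card V \<and> 2 * card {v\<in>V. f v < m} \<le> card V"
proof -
  define A where "A = {t \<in> f ` V. 2 * card {v\<in>V. t < f v} \<le> card V}"
  have finA: "finite A" using finite_V by (simp add: A_def)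
  have none_above: "{v\<in>V. Max (f ` V) < f v} = {}"
    using finite_V by (auto simp: not_less)
  have "Max (f ` V) \<in> A"
    unfolding A_def using finite_V V_nonempty none_above
    by (simp only: mem_Collect_eq card.empty) (simp del: Max_less_iff)
  then have A_ne: "A \<noteq> {}" by blast
  define m where "m = Min A"
  have m: "m \<in> A" using finA A_ne by (simp add: m_def)
  have "2 * card {v\<in>V. f v < m} \<le> card V"
  proof (cases "{v\<in>V. f v < m} = {}")
    case False
    let ?L = "{v\<in>V. f v < m}"
    define t where "t = Max (f ` ?L)"
    have finL: "finite ?L" using finite_V by simp
    have "t \<in> f ` ?L" unfolding t_def using finL False by (intro Max_in) auto
    then have t: "t \<in> f ` V" "t < m" by auto
    have "t \<notin> A" using t(2) Min_le[OF finA, of t] by (auto simp: m_def simp del: Min_gr_iff)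
    then have big: "card V < 2 * card {v\<in>V. t < f v}" using t(1) by (simp add: A_def)
    have "f v \<le> t" if "v \<in> ?L" for v using that finL by (simp add: t_def)
    then have "?L \<inter> {v\<in>V. t < f v} = {}" by force
    then have "card ?L + card {v\<in>V. t < f v} = card (?L \<union> {v\<in>V. t < f v})"
      using finite_V by (simp add: card_Un_disjoint)
    also have "\<dots> \<le> card V" using finite_V by (intro card_mono) auto
    finally show ?thesis using big by linarith
  qed (simp only: card.empty)
  with m show ?thesis by (auto simp: A_def)
qed

text \<open>The positive and negative parts of \<open>f - m\<close>, for a median \<open>m\<close>,
  each live on at most half of \<open>V\<close>, so the bound for nonnegative functions applies to
  both. Shifting by \<open>m\<close> does not decrease the norm because \<open>f\<close> sums to
  zero, and splitting into parts does not increase the Dirichlet form.\<close>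

lemma cheeger_inequality:
  fixes f :: "'a \<Rightarrow> real"
  assumes "(\<Sum>v\<in>V. f v) = 0"
  shows "\<phi>\<^sup>2 * d * (\<Sum>v\<in>V. (f v)\<^sup>2) \<le> (\<Sum>u\<in>V. \<Sum>v\<in>V. adj u v * (f u - f v)\<^sup>2)"
proof -
  obtain m where m: "2 * card {v\<in>V. m < f v} \<le> card V" "2 * card {v\<in>V. f v < m} \<le> card V"
    using exists_median by blast
  define g where "g v = max 0 (f v - m)" for v
  define h where "h v = max 0 (m - f v)" for v
  have supp: "{v\<in>V. 0 < g v} = {v\<in>V. m < f v}" "{v\<in>V. 0 < h v} = {v\<in>V. f v < m}"
    by (auto simp: g_def h_def less_max_iff_disj)
  have "(g v)\<^sup>2 + (h v)\<^sup>2 = (f v)\<^sup>2 - 2 * m * f v + m\<^sup>2" for v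
    by (auto simp: g_def h_def max_def power2_eq_square algebra_simps)
  then have "(\<Sum>v\<in>V. (g v)\<^sup>2) + (\<Sum>v\<in>V. (h v)\<^sup>2) = (\<Sum>v\<in>V. (f v)\<^sup>2) + card V * m\<^sup>2"
    using assms by (simp add: sum.distrib[symmetric])
      (simp add: sum.distrib sum_subtractf sum_distrib_left[symmetric])
  then have "(\<Sum>v\<in>V. (f v)\<^sup>2) \<le> (\<Sum>v\<in>V. (g v)\<^sup>2) + (\<Sum>v\<in>V. (h v)\<^sup>2)"
    by simp
  then have "\<phi>\<^sup>2 * d * (\<Sum>v\<in>V. (f v)\<^sup>2)
      \<le> \<phi>\<^sup>2 * d * ((\<Sum>v\<in>V. (g v)\<^sup>2) + (\<Sum>v\<in>V. (h v)\<^sup>2))"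
    by (intro mult_left_mono) auto
  also have "\<dots> \<le> (\<Sum>u\<in>V. \<Sum>v\<in>V. adj u v * (g u - g v)\<^sup>2)
      + (\<Sum>u\<in>V. \<Sum>v\<in>V. adj u v * (h u - h v)\<^sup>2)"
    using dirichlet_form_bound_nonneg[of g] dirichlet_form_bound_nonneg[of h] m supp
    by (simp add: g_def h_def distrib_left)
  also have "\<dots> = (\<Sum>u\<in>V. \<Sum>v\<in>V. adj u v * ((g u - g v)\<^sup>2 + (h u - h v)\<^sup>2))"
    by (simp add: sum.distrib distrib_left)
  also have "\<dots> \<le> (\<Sum>u\<in>V. \<Sum>v\<in>V. adj u v * (f u - f v)\<^sup>2)"
  proof (intro sum_mono mult_left_mono adj_nonneg)
    fix u v
    \<comment> \<open>The positive part increases with \<open>f\<close> and the negative part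
      decreases, so the two differences never have opposite signs.\<close>
    have cross: "0 \<le> (g u - g v) * (h v - h u)"
      by (cases "f v \<le> f u") (auto simp: g_def h_def max_def intro: mult_nonneg_nonneg mult_nonpos_nonpos)
    have "f u - f v = (g u - g v) + (h v - h u)"
      by (auto simp: g_def h_def max_def)
    then have "(f u - f v)\<^sup>2 = (g u - g v)\<^sup>2 + (h u - h v)\<^sup>2 + 2 * ((g u - g v) * (h v - h u))"
      by (simp only:) (simp add: power2_eq_square algebra_simps)
    then show "(g u - g v)\<^sup>2 + (h u - h v)\<^sup>2 \<le> (f u - f v)\<^sup>2"
      using cross by linarith
  qed
  finally show ?thesis .
qed

section \<open>Contraction of the lazy operator and convergence of the walk\<close>

definition lazy_op :: "('a \<Rightarrow> real) \<Rightarrow> 'a \<Rightarrow> real" where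
  "lazy_op f v = f v / 2 + (\<Sum>u\<in>V. adj v u * f u) / (2 * d)"

text \<open>\<open>lazy_op f v\<close> is the average of \<open>(f v + f u) / 2\<close> over the
  neighbours \<open>u\<close>. After Cauchy-Schwarz, the parallelogram identity shows the loss to be
  the Dirichlet form, which Cheeger's inequality bounds below. Laziness enters through the sums
  \<open>f v + f u\<close> and spares any discussion of negative eigenvalues.\<close>

lemma lazy_op_contraction:
  assumes "(\<Sum>v\<in>V. f v) = 0"
  shows "(\<Sum>v\<in>V. (lazy_op f v)\<^sup>2) \<le> (1 - \<phi>\<^sup>2 / 4) * (\<Sum>v\<in>V. (f v)\<^sup>2)"
proof -
  have "4 * d * (lazy_op f v)\<^sup>2 \<le> (\<Sum>u\<in>V. adj v u * (f v + f u)\<^sup>2)" if "v \<in> V" for v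
  proof -
    have adj_sq: "(adj v u)\<^sup>2 = adj v u" for u by (simp add: adj_def)
    have "2 * d * lazy_op f v = (\<Sum>u\<in>V. adj v u * (f v + f u))"
      using d_pos
      by (simp add: lazy_op_def distrib_left sum.distrib sum_distrib_right[symmetric] sum_adj[OF that])
    \<comment> \<open>\<open>adj\<close> is 0-1 valued; repeating it lets Cauchy-Schwarz yield the
      factor \<open>d\<close> and keep the second sum on neighbours.\<close>
    also have "\<dots> = (\<Sum>u\<in>V. adj v u * (adj v u * (f v + f u)))"
      by (intro sum.cong refl) (simp add: adj_def)
    finally have "(2 * d * lazy_op f v)\<^sup>2 \<le> (\<Sum>u\<in>V. (adj v u)\<^sup>2) * (\<Sum>u\<in>V. (adj v u * (f v + f u))\<^sup>2)"
      by (simp only: Cauchy_Schwarz_ineq_sum)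
    also have "\<dots> = d * (\<Sum>u\<in>V. adj v u * (f v + f u)\<^sup>2)"
      by (simp add: power_mult_distrib adj_sq sum_adj[OF that])
    finally have "d * (4 * d * (lazy_op f v)\<^sup>2) \<le> d * (\<Sum>u\<in>V. adj v u * (f v + f u)\<^sup>2)"
      by (simp add: power2_eq_square algebra_simps)
    then show ?thesis using d_pos by simp
  qed
  then have "4 * d * (\<Sum>v\<in>V. (lazy_op f v)\<^sup>2) \<le> (\<Sum>v\<in>V. \<Sum>u\<in>V. adj v u * (f v + f u)\<^sup>2)"
    unfolding sum_distrib_left by (rule sum_mono)
  also have "\<dots> = (\<Sum>v\<in>V. \<Sum>u\<in>V. adj v u * (2 * (f v)\<^sup>2) + adj v u * (2 * (f u)\<^sup>2)
      - adj v u * (f v - f u)\<^sup>2)"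
    by (intro sum.cong refl) (simp add: power2_eq_square algebra_simps)
  also have "\<dots> = 4 * d * (\<Sum>v\<in>V. (f v)\<^sup>2) - (\<Sum>v\<in>V. \<Sum>u\<in>V. adj v u * (f v - f u)\<^sup>2)"
    by (simp only: sum.distrib sum_subtractf sum_adj_left sum_adj_right sum_distrib_left[symmetric])
  also have "\<dots> \<le> 4 * d * (\<Sum>v\<in>V. (f v)\<^sup>2) - \<phi>\<^sup>2 * d * (\<Sum>v\<in>V. (f v)\<^sup>2)"
    using cheeger_inequality[OF assms] by simp
  finally have "(4 * d) * (\<Sum>v\<in>V. (lazy_op f v)\<^sup>2)
      \<le> (4 * d) * ((1 - \<phi>\<^sup>2 / 4) * (\<Sum>v\<in>V. (f v)\<^sup>2))"
    by (simp add: algebra_simps)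
  then show ?thesis using d_pos by simp
qed

lemma neighbours_finite_nonempty:
  assumes "v \<in> V"
  shows "finite {w. (v, w) \<in> parcs G}" "{w. (v, w) \<in> parcs G} \<noteq> {}"
  using card_neighbours[OF assms] d_pos card_gt_0_iff[of "{w. (v, w) \<in> parcs G}"] by simp_all

lemma set_lazy_walk: "x \<in> V \<Longrightarrow> set_pmf (lazy_walk G l x) \<subseteq> V"
proof (induction l)
  case (Suc l)
  have "set_pmf (lazy_step G v) \<subseteq> V" if "v \<in> V" for v
    using that arcs_closed[OF that] set_pmf_of_set[OF neighbours_finite_nonempty(2,1)[OF that]]
    by (auto simp: lazy_step_def split: if_splits)
  then show ?case using Suc by auto
qed simp

lemma pmf_lazy_step:
  assumes "v \<in> V"
  shows "pmf (lazy_step G v) y = of_bool (v = y) / 2 + adj v y / (2 * d)"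
  using neighbours_finite_nonempty[OF assms] card_neighbours[OF assms]
  by (simp add: lazy_step_def pmf_bind adj_def indicator_def)

text \<open>The transition matrix is symmetric, so the operator on functions also moves the density
  of the walk.\<close>

lemma pmf_lazy_walk_Suc:
  assumes "x \<in> V" "y \<in> V"
  shows "pmf (lazy_walk G (Suc l) x) y = lazy_op (pmf (lazy_walk G l x)) y"
proof -
  let ?p = "pmf (lazy_walk G l x)"
  have "pmf (lazy_walk G (Suc l) x) y = (\<Sum>v\<in>V. pmf (lazy_step G v) y * ?p v)"
    using set_lazy_walk[OF assms(1), of l] finite_V
    by (auto simp: pmf_bind intro!: integral_measure_pmf_real)
  also have "\<dots> = (\<Sum>v\<in>V. (if v = y then ?p v / 2 else 0) + adj y v * ?p v / (2 * d))"
    by (intro sum.cong refl) (simp add: pmf_lazy_step adj_commute[of y] algebra_simps)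
  also have "\<dots> = lazy_op ?p y"
    using assms(2) finite_V
    by (simp add: lazy_op_def sum.distrib sum_divide_distrib)
  finally show ?thesis .
qed

text \<open>Subtracting the uniform density, which \<open>lazy_op\<close> fixes, leaves a function
  of sum zero, so every step contracts. The bound \<open>\<phi> \<le> 2\<close> keeps the
  contraction factor nonnegative.\<close>

lemma lazy_walk_l2_bound:
  assumes x: "x \<in> V" and "\<phi> \<le> 2"
  shows "(\<Sum>y\<in>V. (pmf (lazy_walk G l x) y - 1 / card V)\<^sup>2) \<le> (1 - \<phi>\<^sup>2 / 4) ^ l"
proof (induction l)
  case 0
  have N: "0 < card V" using finite_V V_nonempty by (simp add: card_gt_0_iff)
  have "(\<Sum>y\<in>V. (pmf (lazy_walk G 0 x) y - 1 / card V)\<^sup>2)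
    = (\<Sum>y\<in>V. of_bool (y = x) * (1 - 2 / card V) + 1 / (card V)\<^sup>2)"
    by (intro sum.cong refl) (auto simp: indicator_def power2_diff power_divide)
  also have "\<dots> = 1 - 1 / card V"
    using finite_V x N
    by (simp add: sum.distrib sum_distrib_right[symmetric] of_bool_def)
       (simp add: power2_eq_square field_simps)
  finally show ?case using N by simp
next
  case (Suc l)
  let ?f = "\<lambda>y. pmf (lazy_walk G l x) y - 1 / card V"
  have N: "0 < card V" using finite_V V_nonempty by (simp add: card_gt_0_iff)
  have "(\<Sum>y\<in>V. ?f y) = 0"
    using N sum_pmf_eq_1[OF finite_V set_lazy_walk[OF x]] by (simp add: sum_subtractf)
  note contr = lazy_op_contraction[OF this]
  have "pmf (lazy_walk G (Suc l) x) y - 1 / card V = lazy_op ?f y" if "y \<in> V" for y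
    using pmf_lazy_walk_Suc[OF x that, of l] sum_adj[OF that] d_pos
    by (simp del: lazy_walk.simps add: lazy_op_def right_diff_distrib sum_subtractf
        sum_divide_distrib[symmetric] field_simps)
  then have "(\<Sum>y\<in>V. (pmf (lazy_walk G (Suc l) x) y - 1 / card V)\<^sup>2) = (\<Sum>y\<in>V. (lazy_op ?f y)\<^sup>2)"
    by simp
  also have "\<dots> \<le> (1 - \<phi>\<^sup>2 / 4) * (\<Sum>y\<in>V. (?f y)\<^sup>2)" by (rule contr)
  also have "\<dots> \<le> (1 - \<phi>\<^sup>2 / 4) * (1 - \<phi>\<^sup>2 / 4) ^ l"
    using power_mono[OF assms(2), of 2] \<phi>_pos by (intro mult_left_mono Suc) auto
  finally show ?case by simp
qed

lemma lazy_walk_l1_bound: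
  assumes x: "x \<in> V" and "\<phi> \<le> 2"
  shows "(\<Sum>y\<in>V. \<bar>pmf (lazy_walk G l x) y - 1 / card V\<bar>)
    \<le> sqrt (card V) * exp (- (\<phi>\<^sup>2 * l / 8))"
proof -
  let ?f = "\<lambda>y. pmf (lazy_walk G l x) y - 1 / card V"
  have "(\<Sum>y\<in>V. \<bar>?f y\<bar>)\<^sup>2 \<le> (\<Sum>y\<in>V. (?f y)\<^sup>2) * card V"
    using sum_squared_le_sum_of_squares[of "\<lambda>y. \<bar>?f y\<bar>" V] by simp
  also have "\<dots> \<le> (1 - \<phi>\<^sup>2 / 4) ^ l * card V"
    by (intro mult_right_mono lazy_walk_l2_bound assms) simp
  also have "\<dots> \<le> exp (- (\<phi>\<^sup>2 / 4)) ^ l * card V"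
    using power_mono[OF assms(2), of 2] \<phi>_pos exp_ge_add_one_self[of "- (\<phi>\<^sup>2 / 4)"]
    by (intro mult_right_mono power_mono) auto
  also have "\<dots> = (sqrt (card V) * exp (- (\<phi>\<^sup>2 * l / 8)))\<^sup>2"
    by (simp add: power_mult_distrib exp_of_nat_mult[symmetric] exp_double[symmetric] mult.commute)
  finally show ?thesis by (rule power2_le_imp_le) simp
qed

text \<open>The distance is summed over a larger \<open>W\<close> because answers are later compared
  on the full vertex set; both distributions vanish off \<open>V\<close>.\<close>

lemma lazy_walk_near_uniform:
  assumes "x \<in> V" "\<phi> \<le> 2" "V \<subseteq> W" "finite W"
  shows "(\<Sum>a\<in>W. \<bar>pmf (lazy_walk G l x) a - pmf (pmf_of_set V) a\<bar>)
    \<le> sqrt (card V) * exp (- (\<phi>\<^sup>2 * l / 8))"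
proof -
  have "(\<Sum>a\<in>W. \<bar>pmf (lazy_walk G l x) a - pmf (pmf_of_set V) a\<bar>)
    = (\<Sum>a\<in>V. \<bar>pmf (lazy_walk G l x) a - 1 / card V\<bar>)"
    using assms set_lazy_walk[OF assms(1), of l] finite_V V_nonempty
    by (intro sum.mono_neutral_cong_right) (auto simp: set_pmf_iff indicator_def)
  also have "\<dots> \<le> sqrt (card V) * exp (- (\<phi>\<^sup>2 * l / 8))"
    by (rule lazy_walk_l1_bound[OF assms(1,2)])
  finally show ?thesis .
qed

end

section \<open>Inequalities for entropy and random signs\<close>

text \<open>Young's inequality \<open>x * y \<le> exp y + x * ln x - x\<close> with
  \<open>ln x\<close> bounded by \<open>x - 1\<close>, which trades relative entropy for a second
  moment.\<close>

lemma mult_le_exp_chi_square: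
  fixes x y :: real
  assumes "0 \<le> x"
  shows "x * y \<le> exp y - 2 * x + x\<^sup>2"
proof (cases "x = 0")
  case False
  with assms have x: "0 < x" by simp
  have "x * y + 2 * x - x\<^sup>2 = x * (1 + (y - (x - 1)))"
    by (simp add: power2_eq_square algebra_simps)
  also have "\<dots> \<le> x * (1 + (y - ln x))"
    using ln_le_minus_one[OF x] x by (intro mult_left_mono) auto
  also have "\<dots> \<le> x * exp (y - ln x)"
    using x by (intro mult_left_mono exp_ge_add_one_self) auto
  also have "\<dots> = exp y" using x by (simp add: exp_diff)
  finally show ?thesis by simp
qed simp

text \<open>The dual form of bounding the relative entropy to the uniform distribution by the \<open>\<chi>\<^sup>2\<close> distance.\<close>

lemma sum_mult_ln_le_chi_square:
  fixes r H :: "'a \<Rightarrow> real"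
  assumes "finite A" "A \<noteq> {}" "\<And>a. a \<in> A \<Longrightarrow> 0 \<le> r a" "\<And>a. a \<in> A \<Longrightarrow> 0 < H a"
    and R: "(\<Sum>a\<in>A. r a) = R" "0 < R"
  shows "(\<Sum>a\<in>A. r a * ln (H a))
    \<le> R * ln ((\<Sum>a\<in>A. H a) / card A) + (card A * (\<Sum>a\<in>A. (r a)\<^sup>2) / R - R)"
proof -
  define N where "N = real (card A)"
  define Z where "Z = (\<Sum>a\<in>A. H a) / N"
  have N: "0 < N" using assms by (simp add: N_def card_gt_0_iff)
  have Z: "0 < Z" using assms N by (auto simp: Z_def intro!: divide_pos_pos sum_pos)
  \<comment> \<open>Termwise this is the pointwise inequality at \<open>x = N * r a / R\<close>, the
    density of \<open>r / R\<close> relative to the uniform distribution, and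
    \<open>y = ln (H a / Z)\<close>.\<close>
  have "(\<Sum>a\<in>A. (N / R) * (r a * ln (H a)) - (N / R) * ln Z * r a)
    \<le> (\<Sum>a\<in>A. H a / Z - (2 * N / R) * r a + (N / R)\<^sup>2 * (r a)\<^sup>2)"
  proof (rule sum_mono)
    fix a assume a: "a \<in> A"
    define k where "k = N / R"
    have "(k * r a) * (ln (H a) - ln Z) \<le> exp (ln (H a) - ln Z) - 2 * (k * r a) + (k * r a)\<^sup>2"
      using a assms N by (intro mult_le_exp_chi_square) (auto simp: k_def)
    also have "exp (ln (H a) - ln Z) = H a / Z" using assms(4)[OF a] Z by (simp add: exp_diff)
    finally have "k * (r a * ln (H a)) - k * ln Z * r a \<le> H a / Z - (2 * k) * r a + k\<^sup>2 * (r a)\<^sup>2"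
      by (simp add: power_mult_distrib algebra_simps)
    then show "(N / R) * (r a * ln (H a)) - (N / R) * ln Z * r a
      \<le> H a / Z - (2 * N / R) * r a + (N / R)\<^sup>2 * (r a)\<^sup>2"
      by (simp add: k_def)
  qed
  then have "(N / R) * (\<Sum>a\<in>A. r a * ln (H a)) - (N / R) * ln Z * R
    \<le> (\<Sum>a\<in>A. H a) / Z - (2 * N / R) * R + (N / R)\<^sup>2 * (\<Sum>a\<in>A. (r a)\<^sup>2)"
    by (simp only: sum_subtractf sum.distrib sum_distrib_left[symmetric] sum_divide_distrib[symmetric] R)
  also have "(\<Sum>a\<in>A. H a) / Z = N"
    using N Z by (auto simp: Z_def)
  finally have "(R / N) * ((N / R) * (\<Sum>a\<in>A. r a * ln (H a)) - (N / R) * ln Z * R)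
    \<le> (R / N) * (N - (2 * N / R) * R + (N / R)\<^sup>2 * (\<Sum>a\<in>A. (r a)\<^sup>2))"
    using R N by (intro mult_left_mono) auto
  also have "(R / N) * ((N / R) * (\<Sum>a\<in>A. r a * ln (H a)) - (N / R) * ln Z * R)
    = (\<Sum>a\<in>A. r a * ln (H a)) - R * ln Z"
    using R(2) N by (simp add: field_simps)
  also have "(R / N) * (N - (2 * N / R) * R + (N / R)\<^sup>2 * (\<Sum>a\<in>A. (r a)\<^sup>2))
    = N * (\<Sum>a\<in>A. (r a)\<^sup>2) / R - R"
    using R(2) N by (simp add: field_simps power2_eq_square)
  finally show ?thesis by (simp add: Z_def N_def)
qed

lemma entropy_le_ln_card:
  fixes p :: "'a \<Rightarrow> real"
  assumes "finite A" "A \<noteq> {}" "\<And>a. a \<in> A \<Longrightarrow> 0 \<le> p a" and sum: "(\<Sum>a\<in>A. p a) = 1"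
  shows "(\<Sum>a\<in>A. p a * ln (1 / p a)) \<le> ln (card A)"
proof -
  let ?N = "real (card A)"
  have N: "0 < ?N" using assms by (simp add: card_gt_0_iff)
  have "(\<Sum>a\<in>A. p a * ln (1 / p a)) \<le> (\<Sum>a\<in>A. p a * ln ?N + (1 / ?N - p a))"
  proof (rule sum_mono)
    fix a assume "a \<in> A"
    then consider "p a = 0" | "0 < p a" using assms(3)[of a] by fastforce
    then show "p a * ln (1 / p a) \<le> p a * ln ?N + (1 / ?N - p a)"
    proof cases
      case 2
      have "p a * ln (1 / p a) = p a * ln ?N + p a * ln (1 / (p a * ?N))"
        using 2 N by (simp add: ln_div ln_mult algebra_simps)
      also have "\<dots> \<le> p a * ln ?N + p a * (1 / (p a * ?N) - 1)"
        using 2 N by (intro add_left_mono mult_left_mono ln_le_minus_one) auto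
      also have "p a * (1 / (p a * ?N) - 1) = 1 / ?N - p a"
        using 2 N by (simp add: field_simps)
      finally show ?thesis .
    qed simp
  qed
  also have "\<dots> = ln ?N"
    using N sum by (simp add: sum.distrib sum_subtractf sum_distrib_right[symmetric])
  finally show ?thesis .
qed

lemma expectation_exp_pos:
  fixes g :: "'a \<Rightarrow> real"
  assumes "finite (set_pmf \<mu>)"
  shows "0 < measure_pmf.expectation \<mu> (\<lambda>y. exp (g y))"
proof -
  obtain y where y: "y \<in> set_pmf \<mu>" using set_pmf_not_empty[of \<mu>] by blast
  have "measure_pmf.expectation \<mu> (\<lambda>y. exp (g y)) = (\<Sum>y\<in>set_pmf \<mu>. exp (g y) * pmf \<mu> y)"
    using assms by (intro integral_measure_pmf_real) auto
  also have "\<dots> > 0" using assms y by (intro sum_pos) (auto simp: pmf_positive)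
  finally show ?thesis .
qed

text \<open>The Gibbs variational principle, using that the density \<open>w / p\<close> is at most \<open>1 / p\<close>.\<close>

lemma expectation_mult_le_ln_mgf:
  fixes \<mu> :: "'a pmf" and w g :: "'a \<Rightarrow> real"
  assumes fin: "finite (set_pmf \<mu>)" and w: "\<And>y. 0 \<le> w y" "\<And>y. w y \<le> 1"
    and p: "p = measure_pmf.expectation \<mu> w" "0 < p"
  shows "measure_pmf.expectation \<mu> (\<lambda>y. w y * g y)
    \<le> p * ln (measure_pmf.expectation \<mu> (\<lambda>y. exp (g y)) / p)"
proof -
  have int [simp]: "integrable \<mu> f" for f :: "'a \<Rightarrow> real"
    using fin by (rule integrable_measure_pmf_finite)
  define Z where "Z = measure_pmf.expectation \<mu> (\<lambda>y. exp (g y))"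
  have Z: "0 < Z"
    unfolding Z_def by (rule expectation_exp_pos[OF fin])
  have "measure_pmf.expectation \<mu> (\<lambda>y. w y * g y) - p * ln (Z / p)
    = measure_pmf.expectation \<mu> (\<lambda>y. w y * g y - w y * ln (Z / p))"
    by (simp add: p(1))
  also have "\<dots> \<le> measure_pmf.expectation \<mu> (\<lambda>y. exp (g y) * (p / Z) - w y)"
  proof (intro integral_mono int)
    fix y
    let ?t = "g y - ln (Z / p)"
    have e: "exp ?t = exp (g y) * (p / Z)" using Z p(2) by (simp add: exp_diff)
    have "w y * g y - w y * ln (Z / p) = w y * (1 + ?t) - w y" by (simp add: algebra_simps)
    also have "\<dots> \<le> w y * exp ?t - w y"
      using w by (intro diff_right_mono mult_left_mono exp_ge_add_one_self) auto
    also have "\<dots> \<le> 1 * exp ?t - w y"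
      using w by (intro diff_right_mono mult_right_mono) auto
    finally show "w y * g y - w y * ln (Z / p) \<le> exp (g y) * (p / Z) - w y" by (simp add: e)
  qed
  also have "\<dots> = Z * (p / Z) - p" by (simp add: p(1) Z_def)
  also have "\<dots> = 0" using Z by simp
  finally show ?thesis by (simp add: Z_def)
qed

section \<open>Random signs: exponential moments and the level-one inequality\<close>

lemma finite_set_random_signs: "finite (set_pmf (random_signs n))"
  unfolding random_signs_def
  by (rule finite_subset[OF set_Pi_pmf_subset']) (auto intro!: finite_PiE_dflt)

lemma random_signs_cases:
  assumes "Y \<in> set_pmf (random_signs n)" "i \<in> {1..n}"
  shows "Y i = 1 \<or> Y i = -1"
  using assms by (auto simp: random_signs_def set_Pi_pmf PiE_dflt_def)

lemma integrable_random_signs [simp]: "integrable (random_signs n) f"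
  for f :: "_ \<Rightarrow> real"
  by (intro integrable_measure_pmf_finite finite_set_random_signs)

text \<open>A weaker form of the bound \<open>exp (x\<^sup>2 / 2)\<close>; it has an elementary
  proof and only affects constants.\<close>

lemma exp_average_le:
  fixes x :: real
  assumes "\<bar>x\<bar> \<le> 1"
  shows "(exp (-x) + exp x) / 2 \<le> exp (x\<^sup>2)"
proof -
  have main: "exp (-t) + exp t \<le> 2 + 2 * t\<^sup>2" if t: "0 \<le> t" "t \<le> 1" for t :: real
  proof -
    \<comment> \<open>The factor \<open>1 + t\<close> of \<open>1 + t ^ 3\<close> is at most
      \<open>exp t\<close>; dividing by \<open>exp t\<close> bounds \<open>exp (-t)\<close> from
      above.\<close>
    have "1 \<le> 1 + t ^ 3" using t by simp
    also have "\<dots> = (1 - t + t\<^sup>2) * (1 + t)" by (simp add: power2_eq_square power3_eq_cube algebra_simps)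
    also have "\<dots> \<le> (1 - t + t\<^sup>2) * exp t"
      using t by (intro mult_left_mono exp_ge_add_one_self) auto
    finally have "exp (-t) \<le> 1 - t + t\<^sup>2" by (simp add: exp_minus field_simps)
    with exp_bound[OF t] show ?thesis by simp
  qed
  have "exp (-x) + exp x \<le> 2 + 2 * x\<^sup>2"
    using main[of "\<bar>x\<bar>"] assms by (cases "0 \<le> x") auto
  then have "(exp (-x) + exp x) / 2 \<le> 1 + x\<^sup>2" by simp
  also have "\<dots> \<le> exp (x\<^sup>2)" by (rule exp_ge_add_one_self)
  finally show ?thesis .
qed

text \<open>Given \<open>Y i\<close>, the products \<open>Y i * Y j\<close> with
  \<open>j \<noteq> i\<close> are independent uniform signs, so the expectation factors over
  \<open>j\<close>.\<close>

lemma random_signs_mgf_bound: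
  fixes b :: "nat \<Rightarrow> real"
  assumes i: "i \<in> {1..n}" and b: "\<And>j. \<bar>b j\<bar> \<le> 1"
  shows "measure_pmf.expectation (random_signs n)
      (\<lambda>Y. exp (\<Sum>j\<in>{1..n} - {i}. b j * (Y i * Y j))) \<le> exp (\<Sum>j\<in>{1..n} - {i}. (b j)\<^sup>2)"
proof -
  let ?A = "{1..n} - {i}" and ?U = "pmf_of_set {-1, 1 :: int}"
  let ?h = "\<lambda>Y :: nat \<Rightarrow> int. exp (\<Sum>j\<in>?A. b j * (Y i * Y j))"
  let ?\<nu> = "Pi_pmf ?A 1 (\<lambda>_. ?U)"
  have fin: "finite (set_pmf ?\<nu>)"
    by (rule finite_subset[OF set_Pi_pmf_subset']) (auto intro!: finite_PiE_dflt)
  have "random_signs n = ?U \<bind> (\<lambda>y. map_pmf (\<lambda>f. f(i := y)) ?\<nu>)"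
    unfolding random_signs_def using Pi_pmf_insert'[of ?A i "1::int" "\<lambda>_. ?U"] i
    by (simp add: insert_absorb map_pmf_def)
  then have "measure_pmf.expectation (random_signs n) ?h
    = (\<Sum>y\<in>{-1, 1}. measure_pmf.expectation ?\<nu> (\<lambda>f. ?h (f(i := y))) / 2)"
    using fin by (simp add: pmf_expectation_bind_pmf_of_set)
  also have "\<dots> \<le> (\<Sum>y\<in>{-1, 1 :: int}. exp (\<Sum>j\<in>?A. (b j)\<^sup>2) / 2)"
  proof (intro sum_mono divide_right_mono)
    fix y :: int assume y: "y \<in> {-1, 1}"
    have "measure_pmf.expectation ?\<nu> (\<lambda>f. ?h (f(i := y)))
      = measure_pmf.expectation ?\<nu> (\<lambda>f. \<Prod>j\<in>?A. exp (b j * (y * f j)))"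
      by (intro Bochner_Integration.integral_cong refl) (simp add: exp_sum)
    also have "\<dots> = (\<Prod>j\<in>?A. measure_pmf.expectation ?U (\<lambda>v. exp (b j * (y * v))))"
      by (intro expectation_prod_Pi_pmf integrable_measure_pmf_finite) auto
    also have "\<dots> \<le> (\<Prod>j\<in>?A. exp ((b j)\<^sup>2))"
    proof (intro prod_mono conjI)
      fix j
      have "measure_pmf.expectation ?U (\<lambda>v. exp (b j * (y * v))) = (exp (- b j) + exp (b j)) / 2"
        using y by (auto simp: integral_pmf_of_set)
      with exp_average_le[OF b[of j]]
      show "measure_pmf.expectation ?U (\<lambda>v. exp (b j * (y * v))) \<le> exp ((b j)\<^sup>2)" by simp
    qed auto
    also have "\<dots> = exp (\<Sum>j\<in>?A. (b j)\<^sup>2)" by (simp add: exp_sum)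
    finally show "measure_pmf.expectation ?\<nu> (\<lambda>f. ?h (f(i := y))) \<le> exp (\<Sum>j\<in>?A. (b j)\<^sup>2)" .
  qed simp
  finally show ?thesis by simp
qed

text \<open>The Gibbs bound is tested on the linear form with coefficients
  \<open>c j / (2 * p)\<close>. Its weighted expectation is \<open>S / (2 * p)\<close>, the
  exponential moment costs only \<open>S / (4 * p)\<close>, and the difference is at most
  \<open>p * ln (1 / p)\<close>.\<close>

lemma random_signs_level_inequality:
  fixes w :: "(nat \<Rightarrow> int) \<Rightarrow> real"
  assumes w: "\<And>Y. 0 \<le> w Y" "\<And>Y. w Y \<le> 1"
    and p: "p = measure_pmf.expectation (random_signs n) w" "0 < p" and i: "i \<in> {1..n}"
  shows "(\<Sum>j\<in>{1..n} - {i}. (measure_pmf.expectation (random_signs n) (\<lambda>Y. w Y * (Y i * Y j)))\<^sup>2)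
    \<le> 4 * p\<^sup>2 * ln (1 / p)"
proof -
  let ?\<mu> = "random_signs n" and ?A = "{1..n} - {i}"
  define c where "c j = measure_pmf.expectation ?\<mu> (\<lambda>Y. w Y * (Y i * Y j))" for j
  \<comment> \<open>The moment bound asks for \<open>\<bar>b j\<bar> \<le> 1\<close> at every index,
    hence the value 0 off \<open>?A\<close>; on \<open>?A\<close> it follows from
    \<open>\<bar>c j\<bar> \<le> p\<close>.\<close>
  define b where "b j = (if j \<in> ?A then c j / (2 * p) else 0)" for j
  define S where "S = (\<Sum>j\<in>?A. (c j)\<^sup>2)"
  have c_le: "\<bar>c j\<bar> \<le> p" if "j \<in> ?A" for j
  proof -
    have "\<bar>c j\<bar> \<le> measure_pmf.expectation ?\<mu> (\<lambda>Y. \<bar>w Y * (Y i * Y j)\<bar>)"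
      unfolding c_def by (rule integral_abs_bound)
    also have "\<dots> = p" unfolding p(1)
    proof (intro integral_cong_AE)
      show "AE Y in ?\<mu>. \<bar>w Y * (Y i * Y j)\<bar> = w Y"
      proof (rule AE_pmfI)
        fix Y assume Y: "Y \<in> set_pmf ?\<mu>"
        show "\<bar>w Y * (Y i * Y j)\<bar> = w Y"
          using random_signs_cases[OF Y i] random_signs_cases[OF Y, of j] that w(1)[of Y] by auto
      qed
    qed auto
    finally show ?thesis .
  qed
  have b_le: "\<bar>b j\<bar> \<le> 1" for j
    using c_le[of j] p(2) by (auto simp: b_def)
  have "measure_pmf.expectation ?\<mu> (\<lambda>Y. w Y * (\<Sum>j\<in>?A. b j * (Y i * Y j))) = (\<Sum>j\<in>?A. b j * c j)"
    by (simp add: c_def sum_distrib_left mult.left_commute[of "w _"])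
  also have "\<dots> = S / (2 * p)"
    unfolding S_def sum_divide_distrib
    by (intro sum.cong refl) (auto simp: b_def power2_eq_square)
  finally have lhs: "measure_pmf.expectation ?\<mu> (\<lambda>Y. w Y * (\<Sum>j\<in>?A. b j * (Y i * Y j))) = S / (2 * p)" .
  let ?Z = "measure_pmf.expectation ?\<mu> (\<lambda>Y. exp (\<Sum>j\<in>?A. b j * (Y i * Y j)))"
  have "(\<Sum>j\<in>?A. (b j)\<^sup>2) = S / (4 * p\<^sup>2)"
    unfolding S_def sum_divide_distrib
    by (intro sum.cong refl) (auto simp: b_def power_divide power_mult_distrib)
  then have Z_le: "?Z \<le> exp (S / (4 * p\<^sup>2))"
    using random_signs_mgf_bound[where b = b, OF i b_le] by simp
  have Z_pos: "0 < ?Z"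
    by (rule expectation_exp_pos[OF finite_set_random_signs])
  have "S / (2 * p) \<le> p * ln (?Z / p)"
    using lhs expectation_mult_le_ln_mgf[OF finite_set_random_signs w p,
        where g = "\<lambda>Y. \<Sum>j\<in>?A. b j * (Y i * Y j)"] by simp
  also have "\<dots> = p * (ln ?Z + ln (1 / p))"
    using Z_pos p(2) by (simp add: ln_div)
  also have "\<dots> \<le> p * (S / (4 * p\<^sup>2) + ln (1 / p))"
  proof (intro mult_left_mono add_right_mono)
    show "ln ?Z \<le> S / (4 * p\<^sup>2)"
      using Z_le ln_le_cancel_iff[OF Z_pos exp_gt_zero, of "S / (4 * p\<^sup>2)"] by simp
  qed (use p in auto)
  also have "\<dots> = S / (4 * p) + p * ln (1 / p)"
    using p(2) by (simp add: field_simps power2_eq_square)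
  finally have "S / (4 * p) \<le> p * ln (1 / p)"
    using p(2) by (simp add: field_simps)
  then show ?thesis
    using p(2) unfolding S_def[symmetric] c_def[symmetric] by (simp add: field_simps power2_eq_square)
qed

section \<open>Answers uniform on a component\<close>

text \<open>The pair of \<open>v\<close> is \<open>(v + 1) div 2\<close>. For signs
  \<open>Y\<close>, the value is 1 on \<open>set1\<close> and -1 on \<open>set2\<close>, so two
  vertices share a component iff the product of their values is 1.\<close>

definition side :: "(nat \<Rightarrow> int) \<Rightarrow> nat \<Rightarrow> int" where
  "side Y v = (if odd v then Y ((v + 1) div 2) else - Y ((v + 1) div 2))"

definition component :: "nat \<Rightarrow> (nat \<Rightarrow> int) \<Rightarrow> nat \<Rightarrow> nat set" where
  "component n Y x = (if x \<in> set1 n Y then set1 n Y else set2 n Y)"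

lemma pair_index_range: "v \<in> {1..2 * n} \<Longrightarrow> (v + 1) div 2 \<in> {1..n :: nat}"
  by auto

lemma side_cases:
  assumes "Y \<in> set_pmf (random_signs n)" "v \<in> {1..2 * n}"
  shows "side Y v = 1 \<or> side Y v = -1"
  using random_signs_cases[OF assms(1) pair_index_range[OF assms(2)]] by (auto simp: side_def)

lemma side_odd: "1 \<le> i \<Longrightarrow> side Y (2 * i - 1) = Y i"
  by (simp add: side_def)

lemma side_even: "side Y (2 * i) = - Y i"
  by (simp add: side_def)

lemma set1_eq:
  assumes Y: "\<forall>i\<in>{1..n}. Y i = 1 \<or> Y i = -1"
  shows "set1 n Y = {v \<in> {1..2 * n}. side Y v = 1}"
proof (intro equalityI subsetI)
  fix v assume "v \<in> set1 n Y"
  then obtain i where i: "i \<in> {1..n}" "v = (if Y i = 1 then 2 * i - 1 else 2 * i)"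
    by (auto simp: set1_def)
  have "1 \<le> v \<and> v \<le> 2 * n" using i by (auto split: if_splits)
  moreover have "side Y v = 1"
    using Y[rule_format, OF i(1)]
  proof
    assume "Y i = 1"
    then show ?thesis using i side_odd[of i Y] by (simp add: side_even)
  next
    assume "Y i = -1"
    then show ?thesis using i side_odd[of i Y] by (simp add: side_even)
  qed
  ultimately show "v \<in> {v \<in> {1..2 * n}. side Y v = 1}" by simp
next
  fix v assume v: "v \<in> {v \<in> {1..2 * n}. side Y v = 1}"
  define i where "i = (v + 1) div 2"
  have i: "i \<in> {1..n}" using v unfolding i_def by (intro pair_index_range) simp
  have "v = (if Y i = 1 then 2 * i - 1 else 2 * i)"
  proof (cases "odd v")
    case True
    then have "v = 2 * i - 1" unfolding i_def by presburger
    then show ?thesis using v i side_odd[of i Y] by simp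
  next
    case False
    then have "v = 2 * i" unfolding i_def by presburger
    then show ?thesis using v i by (simp add: side_even)
  qed
  then show "v \<in> set1 n Y" unfolding set1_def using i by (rule image_eqI)
qed

lemma set2_eq:
  assumes Y: "\<forall>i\<in>{1..n}. Y i = 1 \<or> Y i = -1"
  shows "set2 n Y = {v \<in> {1..2 * n}. side Y v = -1}"
proof -
  have "set2 n Y = set1 n (\<lambda>i. - Y i)"
    unfolding set1_def set2_def using Y by (intro image_cong refl) fastforce
  also have "\<dots> = {v \<in> {1..2 * n}. side (\<lambda>i. - Y i) v = 1}"
    using Y by (intro set1_eq) force
  finally show ?thesis by (auto simp: side_def)
qed

lemma card_set1: "card (set1 n Y) = n"
  unfolding set1_def
  by (subst card_image) (auto intro!: inj_on_inverseI[where g = "\<lambda>v. (v + 1) div 2"])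

lemma card_set2: "card (set2 n Y) = n"
  unfolding set2_def
  by (subst card_image) (auto intro!: inj_on_inverseI[where g = "\<lambda>v. (v + 1) div 2"])

lemma card_component: "card (component n Y x) = n"
  by (simp add: component_def card_set1 card_set2)

lemma component_eq:
  assumes Y: "Y \<in> set_pmf (random_signs n)" and x: "x \<in> {1..2 * n}"
  shows "component n Y x = {v \<in> {1..2 * n}. side Y v = side Y x}"
proof -
  have signs: "\<forall>i\<in>{1..n}. Y i = 1 \<or> Y i = -1"
    using random_signs_cases[OF Y] by blast
  from side_cases[OF Y x] show ?thesis
  proof
    assume "side Y x = 1"
    then show ?thesis using x by (simp add: component_def set1_eq[OF signs])
  next
    assume "side Y x = -1"
    then show ?thesis using x by (simp add: component_def set1_eq[OF signs] set2_eq[OF signs])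
  qed
qed

lemma set_pmf_component:
  assumes "Y \<in> set_pmf (random_signs n)" "x \<in> {1..2 * n}"
  shows "set_pmf (pmf_of_set (component n Y x)) \<subseteq> {1..2 * n}"
proof -
  have "x \<in> component n Y x" "component n Y x \<subseteq> {1..2 * n}"
    using component_eq[OF assms] assms(2) by auto
  then show ?thesis
    using set_pmf_of_set[of "component n Y x"] finite_subset[of _ "{1..2 * n}"] by blast
qed

text \<open>Makes the answer distribution affine in products of two signs, the form that the
  level-one inequality controls.\<close>

lemma pmf_component:
  assumes "Y \<in> set_pmf (random_signs n)" "x \<in> {1..2 * n}" "a \<in> {1..2 * n}"
  shows "pmf (pmf_of_set (component n Y x)) a = (1 + side Y x * side Y a) / (2 * n)"
proof -
  have "x \<in> component n Y x" "finite (component n Y x)" using component_eq[OF assms(1,2)] assms(2) by auto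
  then have "component n Y x \<noteq> {}" by blast
  with \<open>finite _\<close> have "pmf (pmf_of_set (component n Y x)) a = indicator (component n Y x) a / n"
    by (simp add: card_component)
  also have "a \<in> component n Y x \<longleftrightarrow> side Y a = side Y x"
    using component_eq[OF assms(1,2)] assms(3) by simp
  then have "indicator (component n Y x) a = (1 + real_of_int (side Y x) * side Y a) / 2"
    using side_cases[OF assms(1,2)] side_cases[OF assms(1,3)] by (elim disjE) simp_all
  finally show ?thesis by simp
qed

lemma sum_pair_index:
  fixes g :: "nat \<Rightarrow> real"
  shows "(\<Sum>v\<in>{1..2 * n}. g ((v + 1) div 2)) = 2 * (\<Sum>j\<in>{1..n}. g j)"
proof (induction n)
  case (Suc n)
  have "{1..2 * Suc n} = insert (2 * n + 1) (insert (2 * n + 2) {1..2 * n})" by auto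
  then have "(\<Sum>v\<in>{1..2 * Suc n}. g ((v + 1) div 2))
    = (\<Sum>v\<in>insert (2 * n + 1) (insert (2 * n + 2) {1..2 * n}). g ((v + 1) div 2))"
    by (simp only:)
  also have "\<dots> = 2 * g (Suc n) + (\<Sum>v\<in>{1..2 * n}. g ((v + 1) div 2))" by simp
  finally show ?case using Suc.IH by simp
qed simp

text \<open>In the application \<open>w\<close> is the likelihood of a memory state given the signs
  and \<open>p\<close> its probability; the expectations on the left are the joint probabilities of
  state and answer. They equal \<open>(p + c a) / (2 * n)\<close> with \<open>c a\<close> the
  weighted correlation of the sides of \<open>x\<close> and \<open>a\<close>, so the second-moment
  excess is a sum of squared correlations.\<close>

lemma component_posterior_bound:
  fixes w :: "(nat \<Rightarrow> int) \<Rightarrow> real" and H :: "nat \<Rightarrow> real"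
  assumes w: "\<And>Y. 0 \<le> w Y" "\<And>Y. w Y \<le> 1"
    and p: "p = measure_pmf.expectation (random_signs n) w"
    and x: "x \<in> {1..2 * n}" and H: "\<And>a. a \<in> {1..2 * n} \<Longrightarrow> 0 < H a"
  shows "(\<Sum>a\<in>{1..2 * n}.
      measure_pmf.expectation (random_signs n) (\<lambda>Y. w Y * pmf (pmf_of_set (component n Y x)) a) * ln (H a))
    \<le> p * ln ((\<Sum>a\<in>{1..2 * n}. H a) / (2 * n)) + p * (1 + 4 * ln (1 / p)) / n"
proof -
  let ?\<mu> = "random_signs n" and ?V = "{1..2 * n}"
  define r where "r a = measure_pmf.expectation ?\<mu> (\<lambda>Y. w Y * pmf (pmf_of_set (component n Y x)) a)" for a
  define c where "c a = measure_pmf.expectation ?\<mu> (\<lambda>Y. w Y * (side Y x * side Y a))" for a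
  define cc where "cc j = measure_pmf.expectation ?\<mu> (\<lambda>Y. w Y * (Y ((x + 1) div 2) * Y j))" for j
  have n: "0 < n" using x by auto
  have r_nonneg: "0 \<le> r a" for a
    unfolding r_def using w by (intro integral_nonneg_AE AE_pmfI) simp
  have sum_r: "(\<Sum>a\<in>?V. r a) = p"
  proof -
    have "(\<Sum>a\<in>?V. r a) = measure_pmf.expectation ?\<mu> (\<lambda>Y. w Y * (\<Sum>a\<in>?V. pmf (pmf_of_set (component n Y x)) a))"
      by (simp add: r_def sum_distrib_left)
    also have "\<dots> = p" unfolding p
    proof (intro integral_cong_AE AE_pmfI)
      fix Y assume Y: "Y \<in> set_pmf ?\<mu>"
      have "(\<Sum>a\<in>?V. pmf (pmf_of_set (component n Y x)) a) = 1"
        using set_pmf_component[OF Y x] by (intro sum_pmf_eq_1) auto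
      then show "w Y * (\<Sum>a\<in>?V. pmf (pmf_of_set (component n Y x)) a) = w Y" by simp
    qed auto
    finally show ?thesis .
  qed
  have p_nonneg: "0 \<le> p" unfolding sum_r[symmetric] by (intro sum_nonneg r_nonneg)
  show ?thesis
  proof (cases "p = 0")
    \<comment> \<open>A state of probability zero makes all joint probabilities, and thus both
      sides, zero.\<close>
    case True
    then have "\<forall>a\<in>?V. r a = 0"
      using sum_r sum_nonneg_eq_0_iff[of ?V r] r_nonneg by simp
    then show ?thesis using True by (simp add: r_def[symmetric])
  next
    case False
    with p_nonneg have p_pos: "0 < p" by simp
    have r_eq: "r a = (p + c a) / (2 * n)" if a: "a \<in> ?V" for a
    proof -
      have "r a = measure_pmf.expectation ?\<mu> (\<lambda>Y. (w Y + w Y * (side Y x * side Y a)) / (2 * n))"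
        unfolding r_def
        by (intro integral_cong_AE AE_pmfI) (auto simp: pmf_component[OF _ x a] algebra_simps)
      then show ?thesis by (simp add: p c_def)
    qed
    have "(\<Sum>a\<in>?V. (p + c a) / (2 * n)) = p"
      using sum_r r_eq by simp
    \<comment> \<open>The constant parts already carry the whole mass \<open>p\<close>; hence the
      cross term in the squares below vanishes.\<close>
    then have sum_c: "(\<Sum>a\<in>?V. c a) = 0"
      using n by (simp add: sum_divide_distrib[symmetric] sum.distrib field_simps)
    have "(\<Sum>a\<in>?V. (r a)\<^sup>2) = (\<Sum>a\<in>?V. (p\<^sup>2 + 2 * p * c a + (c a)\<^sup>2) / (2 * n)\<^sup>2)"
      by (intro sum.cong refl) (simp add: r_eq power_divide power2_sum)
    also have "\<dots> = (2 * n * p\<^sup>2 + (\<Sum>a\<in>?V. (c a)\<^sup>2)) / (2 * n)\<^sup>2"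
      using sum_c by (simp add: sum_divide_distrib[symmetric] sum.distrib sum_distrib_left[symmetric])
    finally have "2 * n * (\<Sum>a\<in>?V. (r a)\<^sup>2) / p - p = (\<Sum>a\<in>?V. (c a)\<^sup>2) / (2 * n * p)"
      using n p_pos by (simp add: power2_eq_square field_simps)
    \<comment> \<open>Up to sign, the correlation depends only on the pairs of the two
      vertices.\<close>
    also have "(\<Sum>a\<in>?V. (c a)\<^sup>2) = (\<Sum>a\<in>?V. (cc ((a + 1) div 2))\<^sup>2)"
    proof (intro sum.cong refl)
      fix a
      have "c a = cc ((a + 1) div 2) \<or> c a = - cc ((a + 1) div 2)"
        by (cases "odd x"; cases "odd a") (simp_all add: c_def cc_def side_def)
      then show "(c a)\<^sup>2 = (cc ((a + 1) div 2))\<^sup>2" by auto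
    qed
    also have "\<dots> = 2 * (\<Sum>j\<in>{1..n}. (cc j)\<^sup>2)" by (rule sum_pair_index)
    also have "(\<Sum>j\<in>{1..n}. (cc j)\<^sup>2)
      = (cc ((x + 1) div 2))\<^sup>2 + (\<Sum>j\<in>{1..n} - {(x + 1) div 2}. (cc j)\<^sup>2)"
      using pair_index_range[OF x] by (intro sum.remove) auto
    \<comment> \<open>The query's own pair is fully correlated with itself; it contributes the 1 in
      \<open>1 + 4 * ln (1 / p)\<close>.\<close>
    also have "cc ((x + 1) div 2) = p" unfolding cc_def p
    proof (intro integral_cong_AE AE_pmfI)
      fix Y assume Y: "Y \<in> set_pmf ?\<mu>"
      show "w Y * (Y ((x + 1) div 2) * Y ((x + 1) div 2)) = w Y"
        using random_signs_cases[OF Y pair_index_range[OF x]] by auto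
    qed auto
    also have "2 * (p\<^sup>2 + (\<Sum>j\<in>{1..n} - {(x + 1) div 2}. (cc j)\<^sup>2)) / (2 * n * p)
      \<le> 2 * (p\<^sup>2 + 4 * p\<^sup>2 * ln (1 / p)) / (2 * n * p)"
      unfolding cc_def using p_pos
      by (intro divide_right_mono mult_left_mono add_left_mono
          random_signs_level_inequality[OF w p p_pos pair_index_range[OF x]]) auto
    also have "\<dots> = p * (1 + 4 * ln (1 / p)) / n"
      using n p_pos by (simp add: power2_eq_square field_simps)
    finally have chi: "2 * n * (\<Sum>a\<in>?V. (r a)\<^sup>2) / p - p \<le> p * (1 + 4 * ln (1 / p)) / n" .
    have "(\<Sum>a\<in>?V. r a * ln (H a)) \<le> p * ln ((\<Sum>a\<in>?V. H a) / card ?V)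
      + (card ?V * (\<Sum>a\<in>?V. (r a)\<^sup>2) / p - p)"
      using n H r_nonneg sum_r p_pos by (intro sum_mult_ln_le_chi_square) auto
    with chi show ?thesis by (simp add: r_def)
  qed
qed

section \<open>Memory distributions for arbitrary answer kernels\<close>

lemma expectation_bind_finite:
  fixes h :: "'b \<Rightarrow> real"
  assumes "finite (set_pmf p)" "\<And>x. x \<in> set_pmf p \<Longrightarrow> finite (set_pmf (f x))"
  shows "measure_pmf.expectation (p \<bind> f) h
    = measure_pmf.expectation p (\<lambda>x. measure_pmf.expectation (f x) h)"
  using assms by (simp add: pmf_expectation_bind[of "set_pmf p"] integral_measure_pmf[of "set_pmf p"])

text \<open>The kernel \<open>K\<close> is arbitrary, so that lazy walks and exactly uniform answers
  drive the same process and can be compared.\<close>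

primrec memory_under :: "(nat \<Rightarrow> nat pmf) \<Rightarrow> rw_program \<Rightarrow> nat \<Rightarrow> bool list pmf" where
  "memory_under K P 0 = return_pmf (start P)"
| "memory_under K P (Suc T) =
     memory_under K P T \<bind> (\<lambda>s. map_pmf (update P T s) (K (query P T s)))"

lemma memory_after_eq_memory_under: "memory_after G l P T = memory_under (lazy_walk G l) P T"
  by (induction T) simp_all

locale space_bounded_program =
  fixes P :: rw_program and M :: nat and V :: "nat set"
  assumes space: "uses_space P M" and queries: "queries_within P M V" and finite_V: "finite V"
begin

abbreviation "states \<equiv> {s :: bool list. length s = M}"

lemma finite_states: "finite states"
  using finite_lists_length_eq[of "UNIV :: bool set" M] by simp

lemma card_states: "card states = 2 ^ M"
  using card_lists_length_eq[of "UNIV :: bool set" M] by simp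

lemma query_in: "s \<in> states \<Longrightarrow> query P t s \<in> V"
  using queries by (simp add: queries_within_def)

lemma update_in: "s \<in> states \<Longrightarrow> update P t s y \<in> states"
  using space by (simp add: uses_space_def)

lemma set_memory_under: "set_pmf (memory_under K P T) \<subseteq> states"
proof (induction T)
  case 0
  then show ?case using space by (simp add: uses_space_def)
next
  case (Suc T)
  then show ?case using update_in by fastforce
qed

lemma finite_memory_under: "finite (set_pmf (memory_under K P T))"
  using finite_subset[OF set_memory_under finite_states] .

lemma integrable_memory_under: "integrable (memory_under K P T) f" for f :: "_ \<Rightarrow> real"
  by (intro integrable_measure_pmf_finite finite_memory_under)

lemma expectation_memory_under:
  fixes f :: "bool list \<Rightarrow> real"
  shows "measure_pmf.expectation (memory_under K P T) f = (\<Sum>s\<in>states. pmf (memory_under K P T) s * f s)"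
  using set_memory_under
  by (subst integral_measure_pmf_real[OF finite_states]) (auto simp: mult.commute)

lemma expectation_memory_under_Suc:
  fixes f :: "bool list \<Rightarrow> real"
  assumes K: "\<And>x. x \<in> V \<Longrightarrow> set_pmf (K x) \<subseteq> V"
  shows "measure_pmf.expectation (memory_under K P (Suc T)) f = measure_pmf.expectation (memory_under K P T)
    (\<lambda>s. \<Sum>a\<in>V. pmf (K (query P T s)) a * f (update P T s a))"
proof -
  have sub: "set_pmf (K (query P T s)) \<subseteq> V" if "s \<in> set_pmf (memory_under K P T)" for s
    using that set_memory_under query_in K by blast
  have "measure_pmf.expectation (memory_under K P (Suc T)) f = measure_pmf.expectation (memory_under K P T)
    (\<lambda>s. measure_pmf.expectation (K (query P T s)) (\<lambda>a. f (update P T s a)))"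
    using finite_subset[OF sub finite_V] finite_memory_under
    by (simp add: expectation_bind_finite)
  also have "\<dots> = measure_pmf.expectation (memory_under K P T)
    (\<lambda>s. \<Sum>a\<in>V. pmf (K (query P T s)) a * f (update P T s a))"
  proof (intro integral_cong_AE AE_pmfI)
    fix s assume "s \<in> set_pmf (memory_under K P T)"
    from sub[OF this]
    show "measure_pmf.expectation (K (query P T s)) (\<lambda>a. f (update P T s a))
      = (\<Sum>a\<in>V. pmf (K (query P T s)) a * f (update P T s a))"
      by (subst integral_measure_pmf_real[OF finite_V]) (auto simp: mult.commute)
  qed auto
  finally show ?thesis .
qed

text \<open>A hybrid argument: exchanging the kernel of the last answer costs at most
  \<open>\<epsilon>\<close>, and averaging over that answer leaves a function of the earlier memory
  with values in [0, 1], to which the induction hypothesis applies.\<close>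

lemma memory_under_stable:
  fixes f :: "bool list \<Rightarrow> real"
  assumes K: "\<And>x. x \<in> V \<Longrightarrow> set_pmf (K x) \<subseteq> V" and K': "\<And>x. x \<in> V \<Longrightarrow> set_pmf (K' x) \<subseteq> V"
    and close: "\<And>x. x \<in> V \<Longrightarrow> (\<Sum>a\<in>V. \<bar>pmf (K x) a - pmf (K' x) a\<bar>) \<le> \<epsilon>"
    and f: "\<And>s. 0 \<le> f s" "\<And>s. f s \<le> 1"
  shows "\<bar>measure_pmf.expectation (memory_under K P T) f - measure_pmf.expectation (memory_under K' P T) f\<bar>
    \<le> T * \<epsilon>"
  using f
proof (induction T arbitrary: f)
  case (Suc T)
  note [simp] = integrable_memory_under
  let ?E = "\<lambda>K. measure_pmf.expectation (memory_under K P T)"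
  define Kf where "Kf K s = (\<Sum>a\<in>V. pmf (K (query P T s)) a * f (update P T s a))" for K s
  \<comment> \<open>The induction hypothesis needs bounds at all bit strings, but queries are known
    to lie in \<open>V\<close> only from \<open>states\<close>. The memory never leaves
    \<open>states\<close>, so the truncation changes no expectation.\<close>
  define g where "g s = (if s \<in> states then Kf K s else 0)" for s
  have mass: "(\<Sum>a\<in>V. pmf (K x) a) = 1" if "x \<in> V" for x
    using K[OF that] finite_V by (intro sum_pmf_eq_1)
  have g_bounds: "0 \<le> g s" "g s \<le> 1" for s
  proof -
    show "0 \<le> g s" using Suc.prems by (auto simp: g_def Kf_def intro!: sum_nonneg)
    have "Kf K s \<le> (\<Sum>a\<in>V. pmf (K (query P T s)) a * 1)"
      unfolding Kf_def using Suc.prems by (intro sum_mono mult_left_mono) auto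
    then show "g s \<le> 1" using mass[OF query_in, of s T] by (auto simp: g_def)
  qed
  have E_g: "?E K'' (Kf K) = ?E K'' g" for K''
    using set_memory_under[of K'' T] by (intro integral_cong_AE AE_pmfI) (auto simp: g_def)
  have "\<bar>?E K' (Kf K) - ?E K' (Kf K')\<bar> = \<bar>?E K' (\<lambda>s. Kf K s - Kf K' s)\<bar>"
    by simp
  also have "\<dots> \<le> ?E K' (\<lambda>s. \<bar>Kf K s - Kf K' s\<bar>)" by (rule integral_abs_bound)
  also have "\<dots> \<le> ?E K' (\<lambda>_. \<epsilon>)"
  proof (intro integral_mono_AE AE_pmfI)
    fix s assume "s \<in> set_pmf (memory_under K' P T)"
    then have s: "s \<in> states" using set_memory_under by blast
    have "\<bar>Kf K s - Kf K' s\<bar>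
      \<le> (\<Sum>a\<in>V. \<bar>pmf (K (query P T s)) a - pmf (K' (query P T s)) a\<bar> * f (update P T s a))"
      unfolding Kf_def sum_subtractf[symmetric] left_diff_distrib[symmetric]
      by (rule order_trans[OF sum_abs]) (simp add: abs_mult Suc.prems)
    also have "\<dots> \<le> (\<Sum>a\<in>V. \<bar>pmf (K (query P T s)) a - pmf (K' (query P T s)) a\<bar> * 1)"
      using Suc.prems by (intro sum_mono mult_left_mono) auto
    also have "\<dots> \<le> \<epsilon>" using close[OF query_in[OF s]] by simp
    finally show "\<bar>Kf K s - Kf K' s\<bar> \<le> \<epsilon>" .
  qed auto
  finally have "\<bar>?E K' (Kf K) - ?E K' (Kf K')\<bar> \<le> \<epsilon>" by simp
  moreover have "\<bar>?E K (Kf K) - ?E K' (Kf K)\<bar> \<le> T * \<epsilon>"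
    unfolding E_g using Suc.IH[OF g_bounds] by simp
  moreover have "measure_pmf.expectation (memory_under K P (Suc T)) f = ?E K (Kf K)"
    unfolding Kf_def using K by (rule expectation_memory_under_Suc)
  moreover have "measure_pmf.expectation (memory_under K' P (Suc T)) f = ?E K' (Kf K')"
    unfolding Kf_def using K' by (rule expectation_memory_under_Suc)
  ultimately show ?case
    by (simp add: distrib_right del: memory_under.simps)
qed simp

end

section \<open>Accumulation of information over the queries\<close>

text \<open>The dual form of the chain rule for the relative entropy of the memory contents for \<open>X = 1\<close>
  with respect to those for \<open>X = 0\<close>, when the answers are exactly uniform.\<close>

lemma memory_log_expectation_bound:
  assumes n: "0 < n" and "uses_space P M" "queries_within P M {1..2 * n}"
    and F: "\<And>s. 0 < F s"
  shows "measure_pmf.expectation (random_signs n) (\<lambda>Y.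
      measure_pmf.expectation (memory_under (\<lambda>x. pmf_of_set (component n Y x)) P T) (\<lambda>s. ln (F s)))
    \<le> ln (measure_pmf.expectation (memory_under (\<lambda>_. pmf_of_set {1..2 * n}) P T) F)
      + T * ((1 + 4 * M * ln 2) / n)"
  using F
proof (induction T arbitrary: F)
  case 0
  then show ?case by simp
next
  case (Suc T)
  let ?V = "{1..2 * n}" and ?\<mu> = "random_signs n"
  interpret space_bounded_program P M ?V
    using assms by unfold_locales auto
  define m where "m Y = memory_under (\<lambda>x. pmf_of_set (component n Y x)) P" for Y
  define p where "p s = measure_pmf.expectation ?\<mu> (\<lambda>Y. pmf (m Y T) s)" for s
  \<comment> \<open>\<open>F'\<close> pulls \<open>F\<close> back through one round for
    \<open>X = 0\<close> by averaging over a uniform answer; the induction hypothesis is applied to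
    it.\<close>
  define F' where "F' s = (\<Sum>a\<in>?V. F (update P T s a)) / (2 * n)" for s
  have F'_pos: "0 < F' s" for s
    using n Suc.prems by (auto simp: F'_def intro!: divide_pos_pos sum_pos)
  have p_nonneg: "0 \<le> p s" for s
    unfolding p_def by (intro integral_nonneg_AE AE_pmfI) simp
  have sum_p: "(\<Sum>s\<in>states. p s) = 1"
  proof -
    have "(\<Sum>s\<in>states. p s) = measure_pmf.expectation ?\<mu> (\<lambda>Y. \<Sum>s\<in>states. pmf (m Y T) s)"
      by (simp add: p_def)
    also have "\<dots> = 1"
      using sum_pmf_eq_1[OF finite_states set_memory_under] by (simp add: m_def)
    finally show ?thesis .
  qed
  have "measure_pmf.expectation ?\<mu> (\<lambda>Y. measure_pmf.expectation (m Y (Suc T)) (\<lambda>s. ln (F s)))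
    = measure_pmf.expectation ?\<mu> (\<lambda>Y. \<Sum>s\<in>states. \<Sum>a\<in>?V.
        (pmf (m Y T) s * pmf (pmf_of_set (component n Y (query P T s))) a) * ln (F (update P T s a)))"
  proof (intro integral_cong_AE AE_pmfI)
    fix Y assume Y: "Y \<in> set_pmf ?\<mu>"
    show "measure_pmf.expectation (m Y (Suc T)) (\<lambda>s. ln (F s)) = (\<Sum>s\<in>states. \<Sum>a\<in>?V.
        (pmf (m Y T) s * pmf (pmf_of_set (component n Y (query P T s))) a) * ln (F (update P T s a)))"
      unfolding m_def
      by (subst expectation_memory_under_Suc, erule set_pmf_component[OF Y])
         (simp add: expectation_memory_under sum_distrib_left mult.assoc)
  qed auto
  also have "\<dots> = (\<Sum>s\<in>states. \<Sum>a\<in>?V. measure_pmf.expectation ?\<mu>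
      (\<lambda>Y. pmf (m Y T) s * pmf (pmf_of_set (component n Y (query P T s))) a) * ln (F (update P T s a)))"
    by simp
  \<comment> \<open>For each state \<open>s\<close>, the weight \<open>w\<close> is its probability
    given \<open>Y\<close>.\<close>
  also have "\<dots> \<le> (\<Sum>s\<in>states. p s * ln (F' s) + p s * (1 + 4 * ln (1 / p s)) / n)"
    unfolding F'_def
    by (intro sum_mono component_posterior_bound)
       (use query_in Suc.prems in \<open>auto simp: p_def pmf_le_1\<close>)
  also have "\<dots> = (\<Sum>s\<in>states. p s * ln (F' s))
      + ((\<Sum>s\<in>states. p s) + 4 * (\<Sum>s\<in>states. p s * ln (1 / p s))) / n"
    by (simp add: sum.distrib distrib_left sum_divide_distrib[symmetric] sum_distrib_left mult.left_commute)
  also have "\<dots> \<le> (\<Sum>s\<in>states. p s * ln (F' s)) + (1 + 4 * ln (card states)) / n"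
  proof -
    have "states \<noteq> {}" using card_states by (intro notI) simp
    then show ?thesis
      using entropy_le_ln_card[OF finite_states _ _ sum_p] p_nonneg sum_p n
      by (intro add_left_mono divide_right_mono) auto
  qed
  also have "ln (card states) = M * ln 2" by (simp add: card_states ln_realpow)
  also have "(\<Sum>s\<in>states. p s * ln (F' s))
    = measure_pmf.expectation ?\<mu> (\<lambda>Y. measure_pmf.expectation (m Y T) (\<lambda>s. ln (F' s)))"
    by (simp add: p_def m_def expectation_memory_under)
  also have "\<dots> \<le> ln (measure_pmf.expectation (memory_under (\<lambda>_. pmf_of_set ?V) P T) F')
      + T * ((1 + 4 * M * ln 2) / n)"
    unfolding m_def by (rule Suc.IH[OF F'_pos])
  also have "measure_pmf.expectation (memory_under (\<lambda>_. pmf_of_set ?V) P T) F'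
    = measure_pmf.expectation (memory_under (\<lambda>_. pmf_of_set ?V) P (Suc T)) F"
    using n by (subst expectation_memory_under_Suc)
      (auto simp: F'_def sum_divide_distrib indicator_def intro!: Bochner_Integration.integral_cong sum.cong)
  finally show ?case
    by (simp add: m_def distrib_right mult.assoc add_divide_distrib del: memory_under.simps)
qed

text \<open>The dual bound is tested on \<open>exp (\<delta> * of_bool (verdict P s))\<close>. Since
  \<open>exp \<delta> \<le> 1 + \<delta> + \<delta>\<^sup>2\<close>, dividing by
  \<open>\<delta>\<close> leaves an error \<open>\<delta>\<close> plus the entropy bound over
  \<open>\<delta>\<close>, in place of Pinsker's inequality.\<close>

lemma ideal_advantage_bound:
  fixes \<delta> :: real
  assumes n: "0 < n" and P: "uses_space P M" "queries_within P M {1..2 * n}"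
    and delta: "0 < \<delta>" "\<delta> \<le> 1"
  shows "measure_pmf.expectation (random_signs n) (\<lambda>Y.
      measure_pmf.expectation (memory_under (\<lambda>x. pmf_of_set (component n Y x)) P T) (\<lambda>s. of_bool (verdict P s)))
    \<le> measure_pmf.expectation (memory_under (\<lambda>_. pmf_of_set {1..2 * n}) P T) (\<lambda>s. of_bool (verdict P s))
      + \<delta> + T * (1 + 4 * M * ln 2) / (n * \<delta>)"
proof -
  let ?\<mu> = "random_signs n"
  interpret space_bounded_program P M "{1..2 * n}"
    using assms by unfold_locales auto
  note [simp] = integrable_memory_under
  define p :: real where "p = measure_pmf.expectation ?\<mu> (\<lambda>Y.
    measure_pmf.expectation (memory_under (\<lambda>x. pmf_of_set (component n Y x)) P T) (\<lambda>s. of_bool (verdict P s)))"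
  let ?E = "measure_pmf.expectation (memory_under (\<lambda>_. pmf_of_set {1..2 * n}) P T)"
  define q :: real where "q = ?E (\<lambda>s. of_bool (verdict P s))"
  define F where "F s = exp (\<delta> * of_bool (verdict P s))" for s
  have "q \<le> ?E (\<lambda>_. 1)" unfolding q_def by (intro integral_mono) auto
  then have q: "q \<le> 1" by simp
  have "?E F \<le> ?E (\<lambda>s. 1 + (\<delta> + \<delta>\<^sup>2) * of_bool (verdict P s))"
    using exp_bound[of \<delta>] delta by (intro integral_mono) (auto simp: F_def)
  also have "\<dots> = 1 + (\<delta> + \<delta>\<^sup>2) * q" by (simp add: q_def)
  finally have EF: "?E F \<le> 1 + (\<delta> + \<delta>\<^sup>2) * q" .
  have "0 < ?E F" unfolding F_def by (intro expectation_exp_pos finite_memory_under)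
  then have "ln (?E F) \<le> (\<delta> + \<delta>\<^sup>2) * q"
    using ln_le_minus_one[of "?E F"] EF by simp
  also have "\<dots> \<le> \<delta> * q + \<delta>\<^sup>2"
    using mult_left_mono[OF q, of "\<delta>\<^sup>2"] by (simp add: algebra_simps)
  finally have "\<delta> * p \<le> \<delta> * q + \<delta>\<^sup>2 + T * ((1 + 4 * M * ln 2) / n)"
    using memory_log_expectation_bound[OF n P, of F T] by (simp add: F_def p_def)
  also have "T * ((1 + 4 * M * ln 2) / n) = \<delta> * (T * (1 + 4 * M * ln 2) / (n * \<delta>))"
    using delta n by simp
  finally have "\<delta> * p \<le> \<delta> * (q + \<delta> + T * (1 + 4 * M * ln 2) / (n * \<delta>))"
    by (simp only: power2_eq_square distrib_left)
  then show ?thesis using delta unfolding p_def q_def by simp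
qed

section \<open>The lower bound\<close>

lemma out_degree_with_proj: "out_degree (with_proj G) v = card {w. (v, w) \<in> parcs G}"
proof -
  have "out_arcs (with_proj G) v = Pair v ` {w. (v, w) \<in> parcs G}"
    by (auto simp: out_arcs_def)
  then show ?thesis by (simp add: out_degree_def card_image inj_on_def)
qed

text \<open>\<open>H\<close> contains all arcs of \<open>G\<close> leaving its vertices, so it is
  \<open>d\<close>-regular too and the volume condition in \<open>conductance\<close> becomes one on
  cardinalities.\<close>

lemma regular_expander_componentI:
  fixes G H :: "'a pair_pre_digraph"
  assumes G: "regular_graph d G" and H: "pair_graph H" "expander \<phi> H"
    and sub: "pverts H \<subseteq> pverts G" and ne: "pverts H \<noteq> {}"
    and arcs: "\<And>u v. u \<in> pverts H \<Longrightarrow> (u, v) \<in> parcs G \<longleftrightarrow> (u, v) \<in> parcs H"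
    and "0 < d" "0 < \<phi>"
  shows "regular_expander_component G (pverts H) d \<phi>"
proof
  interpret G: pair_graph G using G by (simp add: regular_graph_def)
  interpret H: pair_graph H by fact
  show fin: "finite (pverts H)" by (rule H.pair_finite_verts)
  show "pverts H \<noteq> {}" "0 < d" "0 < \<phi>" by fact+
  show "(v, u) \<in> parcs G" if "(u, v) \<in> parcs G" for u v
    using G.pair_sym_arcs that by (auto simp: symmetric_def sym_def)
  show "v \<in> pverts H" if "u \<in> pverts H" "(u, v) \<in> parcs G" for u v
    using that arcs H.in_arcsD2 by blast
  show card_G: "card {v. (u, v) \<in> parcs G} = d" if "u \<in> pverts H" for u
    using that G sub by (auto simp: regular_graph_def out_degree_with_proj)
  fix C assume C: "C \<subseteq> pverts H" "C \<noteq> {}" "2 * card C \<le> card (pverts H)"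
  have vol: "vol H B = d * card B" if "B \<subseteq> pverts H" for B
  proof -
    have "out_degree (with_proj H) v = d" if "v \<in> B" for v
      using that \<open>B \<subseteq> pverts H\<close> card_G[of v] arcs[of v] by (auto simp: out_degree_with_proj)
    then show ?thesis by (simp add: vol_def)
  qed
  have C_pos: "0 < card C" using C(2) finite_subset[OF C(1) fin] by (simp add: card_gt_0_iff)
  let ?Q = "{real (cut_size H C) / real (vol H C) | C.
     C \<subseteq> pverts H \<and> 0 < vol H C \<and> real (vol H C) \<le> real (vol H (pverts H)) / 2}"
  \<comment> \<open>Finiteness of \<open>?Q\<close> is what makes \<open>Min\<close> a lower bound
    of its elements.\<close>
  have "?Q \<subseteq> (\<lambda>C. real (cut_size H C) / real (vol H C)) ` Pow (pverts H)" by auto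
  then have "finite ?Q" using fin finite_subset by blast
  moreover have "real (d * (2 * card C)) \<le> real (d * card (pverts H))"
    unfolding of_nat_le_iff by (intro mult_left_mono C) auto
  then have "real (cut_size H C) / real (vol H C) \<in> ?Q"
    using C C_pos \<open>0 < d\<close> by (auto simp: vol intro!: exI[of _ C])
  ultimately have "conductance H \<le> real (cut_size H C) / real (vol H C)"
    unfolding conductance_def by (rule Min_le)
  with H(2) have "\<phi> \<le> real (cut_size H C) / (real d * card C)"
    using vol[OF C(1)] by (simp add: expander_def)
  then have "\<phi> * d * card C \<le> cut_size H C"
    using C_pos \<open>0 < d\<close> by (simp add: pos_le_divide_eq mult.assoc)
  also have "cut_size H C = card {(u, v) \<in> parcs G. u \<in> C \<and> v \<in> pverts H - C}"
    unfolding cut_size_def using C(1) arcs by (intro arg_cong[of _ _ card]) auto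
  finally show "\<phi> * d * card C \<le> card {(u, v) \<in> parcs G. u \<in> C \<and> v \<in> pverts H - C}" .
qed

text \<open>The two sides are disjoint, so an arc of \<open>G\<close> leaving a vertex of one side
  belongs to the expander on that side.\<close>

lemma regular_expander_component_two_expanders:
  assumes Y: "Y \<in> set_pmf (random_signs n)" and x: "x \<in> {1..2 * n}"
    and G: "regular_graph d G" "two_identical_expanders \<phi> (set1 n Y) (set2 n Y) G"
    and d: "0 < d" "0 < \<phi>"
  shows "regular_expander_component G (component n Y x) d \<phi>"
proof -
  obtain H1 H2 where H: "pair_graph H1" "pair_graph H2" "pverts H1 = set1 n Y" "pverts H2 = set2 n Y"
    "expander \<phi> H1" "expander \<phi> H2" "pverts G = set1 n Y \<union> set2 n Y" "parcs G = parcs H1 \<union> parcs H2"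
    using G(2) unfolding two_identical_expanders_def by blast
  interpret H1: pair_graph H1 by fact
  interpret H2: pair_graph H2 by fact
  have "\<forall>i\<in>{1..n}. Y i = 1 \<or> Y i = -1"
    using random_signs_cases[OF Y] by blast
  then have disj: "set1 n Y \<inter> set2 n Y = {}"
    by (auto simp: set1_eq set2_eq)
  have x_in: "x \<in> component n Y x" using component_eq[OF Y x] x by simp
  show ?thesis
  proof (cases "x \<in> set1 n Y")
    case True
    then have c: "component n Y x = pverts H1" by (simp add: component_def H)
    show ?thesis unfolding c
    proof (rule regular_expander_componentI[OF G(1) H(1,5) _ _ _ d])
      show "(u, v) \<in> parcs G \<longleftrightarrow> (u, v) \<in> parcs H1" if "u \<in> pverts H1" for u v
        using that disj H2.in_arcsD1[of u v] by (auto simp: H)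
    qed (use x_in c H in auto)
  next
    case False
    then have c: "component n Y x = pverts H2" by (simp add: component_def H)
    show ?thesis unfolding c
    proof (rule regular_expander_componentI[OF G(1) H(2,6) _ _ _ d])
      show "(u, v) \<in> parcs G \<longleftrightarrow> (u, v) \<in> parcs H2" if "u \<in> pverts H2" for u v
        using that disj H1.in_arcsD1[of u v] by (auto simp: H)
    qed (use x_in c H in auto)
  qed
qed

section \<open>Error probability of a fixed program\<close>

lemma prob_bind_pmf_ge:
  assumes "\<And>x. x \<in> set_pmf p \<Longrightarrow> c \<le> measure_pmf.prob (f x) B"
  shows "c \<le> measure_pmf.prob (p \<bind> f) B"
proof -
  have "ennreal c = (\<integral>\<^sup>+x. ennreal c \<partial>measure_pmf p)" by simp
  also have "\<dots> \<le> (\<integral>\<^sup>+x. emeasure (f x) B \<partial>measure_pmf p)"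
    using assms by (intro nn_integral_mono_AE AE_pmfI)
      (simp add: measure_pmf.emeasure_eq_measure ennreal_leI)
  also have "\<dots> = ennreal (measure_pmf.prob (p \<bind> f) B)"
    by (simp add: measure_pmf.emeasure_eq_measure[symmetric])
  finally show ?thesis by (simp add: ennreal_le_iff)
qed

definition program_outcome ::
    "nat \<Rightarrow> nat pair_pre_digraph \<Rightarrow> ((nat \<Rightarrow> int) \<Rightarrow> nat pair_pre_digraph) \<Rightarrow>
     nat \<Rightarrow> rw_program \<Rightarrow> nat \<Rightarrow> (bool \<times> bool) pmf" where
  "program_outcome n G0 G1 l P T =
     pmf_of_set (UNIV :: bool set) \<bind> (\<lambda>X. input_graph n G0 G1 X \<bind> (\<lambda>G.
       map_pmf (\<lambda>s. (X, verdict P s)) (memory_after G l P T)))"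

text \<open>The coins are independent of the input, so the program may be drawn first; it then
  suffices to bound the error of each fixed program from below.\<close>

lemma error_prob_eq:
  "error_prob n G0 G1 l \<A> T =
     measure_pmf.prob (\<A> \<bind> (\<lambda>P. program_outcome n G0 G1 l P T)) {(X, guess). guess \<noteq> X}"
  unfolding error_prob_def program_outcome_def
  by (subst bind_commute_pmf[of \<A>]) (subst bind_commute_pmf[of \<A>], rule refl)

lemma prob_program_outcome:
  assumes "uses_space P M" "queries_within P M V" "finite V"
  shows "measure_pmf.prob (program_outcome n G0 G1 l P T) {(X, guess). guess \<noteq> X} =
    (1 + measure_pmf.expectation (memory_after G0 l P T) (\<lambda>s. of_bool (verdict P s))
       - measure_pmf.expectation (random_signs n) (\<lambda>Y.
           measure_pmf.expectation (memory_after (G1 Y) l P T) (\<lambda>s. of_bool (verdict P s)))) / 2"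
proof -
  interpret space_bounded_program P M V using assms by unfold_locales
  note [simp] = integrable_memory_under finite_memory_under memory_after_eq_memory_under
    finite_set_random_signs
  let ?B = "{(X :: bool, guess). guess \<noteq> X}"
  let ?E = "\<lambda>G f. measure_pmf.expectation (memory_after G l P T) f :: real"
  have "measure_pmf.prob (program_outcome n G0 G1 l P T) ?B
    = measure_pmf.expectation (program_outcome n G0 G1 l P T) (indicator ?B)"
    by simp
  also have "\<dots> = (\<Sum>X\<in>UNIV. measure_pmf.expectation (input_graph n G0 G1 X \<bind> (\<lambda>G.
       map_pmf (\<lambda>s. (X, verdict P s)) (memory_after G l P T))) (indicator ?B) / 2)"
    unfolding program_outcome_def
    by (subst pmf_expectation_bind_pmf_of_set) (auto simp: input_graph_def)
  also have "\<dots> = (?E G0 (\<lambda>s. of_bool (verdict P s))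
      + measure_pmf.expectation (random_signs n) (\<lambda>Y. ?E (G1 Y) (\<lambda>s. 1 - of_bool (verdict P s)))) / 2"
  proof -
    have "measure_pmf.expectation (input_graph n G0 G1 False \<bind> (\<lambda>G.
       map_pmf (\<lambda>s. (False, verdict P s)) (memory_after G l P T))) (indicator ?B)
      = ?E G0 (\<lambda>s. of_bool (verdict P s))"
      unfolding input_graph_def
      by (simp only: if_False bind_return_pmf integral_map_pmf indicator_def) (simp add: of_bool_def)
    moreover have "measure_pmf.expectation (input_graph n G0 G1 True \<bind> (\<lambda>G.
       map_pmf (\<lambda>s. (True, verdict P s)) (memory_after G l P T))) (indicator ?B)
      = measure_pmf.expectation (random_signs n) (\<lambda>Y. ?E (G1 Y) (\<lambda>s. 1 - of_bool (verdict P s)))"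
      unfolding input_graph_def
      by (simp only: if_True bind_map_pmf, subst expectation_bind_finite)
         (auto simp only: integral_map_pmf indicator_def finite_set_random_signs set_map_pmf finite_imageI
            memory_after_eq_memory_under finite_memory_under of_bool_def mem_Collect_eq prod.case
            intro!: Bochner_Integration.integral_cong split: if_splits)
    ultimately show ?thesis by (simp add: UNIV_bool)
  qed
  also have "measure_pmf.expectation (random_signs n) (\<lambda>Y. ?E (G1 Y) (\<lambda>s. 1 - of_bool (verdict P s)))
    = 1 - measure_pmf.expectation (random_signs n) (\<lambda>Y. ?E (G1 Y) (\<lambda>s. of_bool (verdict P s)))"
    by simp
  finally show ?thesis by simp
qed

text \<open>The only state is the empty string, so the verdict is constant and the error is 1/2.
  This case is separate because for \<open>M = 0\<close> a bound on \<open>M * T\<close> does not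
  bound \<open>T\<close>.\<close>

lemma expectation_memory_no_space:
  assumes "uses_space P 0" "queries_within P 0 V" "finite V"
  shows "measure_pmf.expectation (memory_after G l P T) f = (f [] :: real)"
proof -
  interpret space_bounded_program P 0 V using assms by unfold_locales
  have "memory_after G l P T = return_pmf []"
    using set_memory_under[of "lazy_walk G l" T]
    by (simp add: memory_after_eq_memory_under set_pmf_subset_singleton[symmetric])
  then show ?thesis by simp
qed

text \<open>Passing to uniform answers costs \<open>T * \<epsilon>\<close> for each value of
  \<open>X\<close>; the remaining loss is the ideal advantage. The factor
  \<open>sqrt (2 * n)\<close> covers components of size \<open>2 * n\<close> and of size
  \<open>n\<close>.\<close>

lemma prob_program_outcome_ge:
  fixes \<delta> \<epsilon> :: real
  assumes n: "0 < n" and d: "0 < d" and \<phi>: "0 < \<phi>" "\<phi> \<le> 2"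
    and G0: "pverts G0 = {1..2 * n}" "regular_graph d G0" "expander \<phi> G0"
    and G1: "\<And>Y. Y \<in> set_pmf (random_signs n) \<Longrightarrow>
       regular_graph d (G1 Y) \<and> two_identical_expanders \<phi> (set1 n Y) (set2 n Y) (G1 Y)"
    and P: "uses_space P M" "queries_within P M {1..2 * n}"
    and \<epsilon>: "sqrt (2 * n) * exp (- (\<phi>\<^sup>2 * l / 8)) \<le> \<epsilon>"
    and \<delta>: "0 < \<delta>" "\<delta> \<le> 1"
  shows "(1 - \<delta> - T * (1 + 4 * M * ln 2) / (n * \<delta>) - 2 * T * \<epsilon>) / 2
    \<le> measure_pmf.prob (program_outcome n G0 G1 l P T) {(X, guess). guess \<noteq> X}"
proof -
  let ?V = "{1..2 * n}" and ?\<mu> = "random_signs n" and ?f = "\<lambda>s. of_bool (verdict P s) :: real"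
  interpret space_bounded_program P M ?V using P by unfold_locales auto
  let ?E = "\<lambda>K. measure_pmf.expectation (memory_under K P T) ?f"
  have "regular_expander_component G0 (pverts G0) d \<phi>"
    using G0 n d \<phi> by (intro regular_expander_componentI) (auto simp: regular_graph_def)
  then interpret G0: regular_expander_component G0 ?V d \<phi> by (simp only: G0)
  have close0: "\<bar>?E (lazy_walk G0 l) - ?E (\<lambda>_. pmf_of_set ?V)\<bar> \<le> T * \<epsilon>"
  proof (intro memory_under_stable)
    fix x assume x: "x \<in> ?V"
    show "set_pmf (lazy_walk G0 l x) \<subseteq> ?V" by (rule G0.set_lazy_walk[OF x])
    show "set_pmf (pmf_of_set ?V) \<subseteq> ?V" using n by simp
    show "(\<Sum>a\<in>?V. \<bar>pmf (lazy_walk G0 l x) a - pmf (pmf_of_set ?V) a\<bar>) \<le> \<epsilon>"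
      using G0.lazy_walk_near_uniform[OF x \<phi>(2) order_refl finite_V, of l] \<epsilon> by simp
  qed auto
  have close1: "?E (lazy_walk (G1 Y) l) \<le> ?E (\<lambda>x. pmf_of_set (component n Y x)) + T * \<epsilon>"
    if Y: "Y \<in> set_pmf ?\<mu>" for Y
  proof -
    have sub: "component n Y x \<subseteq> ?V" "x \<in> component n Y x" if "x \<in> ?V" for x
      using component_eq[OF Y that] that by auto
    have "\<bar>?E (lazy_walk (G1 Y) l) - ?E (\<lambda>x. pmf_of_set (component n Y x))\<bar> \<le> T * \<epsilon>"
    proof (intro memory_under_stable)
      fix x assume x: "x \<in> ?V"
      interpret C: regular_expander_component "G1 Y" "component n Y x" d \<phi>
        using G1[OF Y] d \<phi> by (intro regular_expander_component_two_expanders[OF Y x]) auto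
      show "set_pmf (lazy_walk (G1 Y) l x) \<subseteq> ?V"
        using C.set_lazy_walk[OF sub(2)[OF x]] sub(1)[OF x] by blast
      show "set_pmf (pmf_of_set (component n Y x)) \<subseteq> ?V"
        using C.finite_V C.V_nonempty sub(1)[OF x] by simp
      have "(\<Sum>a\<in>?V. \<bar>pmf (lazy_walk (G1 Y) l x) a - pmf (pmf_of_set (component n Y x)) a\<bar>)
        \<le> sqrt n * exp (- (\<phi>\<^sup>2 * l / 8))"
        using C.lazy_walk_near_uniform[OF sub(2)[OF x] \<phi>(2) sub(1)[OF x] finite_V, of l]
        by (simp add: card_component)
      also have "\<dots> \<le> sqrt (2 * n) * exp (- (\<phi>\<^sup>2 * l / 8))"
        by (intro mult_right_mono) auto
      finally show "(\<Sum>a\<in>?V. \<bar>pmf (lazy_walk (G1 Y) l x) a - pmf (pmf_of_set (component n Y x)) a\<bar>) \<le> \<epsilon>"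
        using \<epsilon> by simp
    qed auto
    then show ?thesis by simp
  qed
  have "measure_pmf.expectation ?\<mu> (\<lambda>Y. ?E (lazy_walk (G1 Y) l))
    \<le> measure_pmf.expectation ?\<mu> (\<lambda>Y. ?E (\<lambda>x. pmf_of_set (component n Y x)) + T * \<epsilon>)"
    by (intro integral_mono_AE AE_pmfI close1) auto
  also have "\<dots> = measure_pmf.expectation ?\<mu> (\<lambda>Y. ?E (\<lambda>x. pmf_of_set (component n Y x))) + T * \<epsilon>"
    by simp
  also have "\<dots> \<le> ?E (\<lambda>_. pmf_of_set ?V) + \<delta> + T * (1 + 4 * M * ln 2) / (n * \<delta>) + T * \<epsilon>"
    using ideal_advantage_bound[OF n P \<delta>, of T] by simp
  finally show ?thesis
    using close0 prob_program_outcome[OF P finite_V, of n G0 G1 l T]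
    by (simp add: memory_after_eq_memory_under)
qed

theorem theorem9:
  fixes \<phi>\<^sub>0 :: real and D :: nat
  assumes "\<phi>\<^sub>0 > 0"
  shows "\<exists>C\<^sub>0>0. \<forall>C\<ge>C\<^sub>0. \<exists>c>0. \<exists>n\<^sub>0. \<forall>n\<ge>n\<^sub>0. \<forall>\<phi> d l G0 G1 \<A> M T.
           0 < \<phi> \<and> \<phi> < 1 \<and> \<phi>\<^sub>0 \<le> \<phi> \<and> 1 \<le> d \<and> d \<le> D \<and>
           C\<^sub>0 * ln (real n) \<le> real l \<and> real l \<le> C * ln (real n) \<and>
           pverts G0 = {1..2 * n} \<and> regular_graph d G0 \<and> expander \<phi> G0 \<and>
           (\<forall>Y\<in>set_pmf (random_signs n).
              regular_graph d (G1 Y) \<and> two_identical_expanders \<phi> (set1 n Y) (set2 n Y) (G1 Y)) \<and>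
           (\<forall>P\<in>set_pmf \<A>. uses_space P M \<and> queries_within P M {1..2 * n}) \<and>
           error_prob n G0 G1 l \<A> T \<le> 1/3
           \<longrightarrow> real M * real T \<ge> c * real n"
proof -
  have main: "real n / 1000 \<le> real M * real T"
    if n: "1 \<le> n" and \<phi>: "0 < \<phi>" "\<phi> < 1" "\<phi>\<^sub>0 \<le> \<phi>" and d: "1 \<le> d"
      and l: "16 / \<phi>\<^sub>0\<^sup>2 * ln (real n) \<le> real l"
      and G0: "pverts G0 = {1..2 * n}" "regular_graph d G0" "expander \<phi> G0"
      and G1: "\<forall>Y\<in>set_pmf (random_signs n).
              regular_graph d (G1 Y) \<and> two_identical_expanders \<phi> (set1 n Y) (set2 n Y) (G1 Y)"
      and P: "\<forall>P\<in>set_pmf \<A>. uses_space P M \<and> queries_within P M {1..2 * n}"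
      and err: "error_prob n G0 G1 l \<A> T \<le> 1/3"
    for n \<phi> d l G0 G1 \<A> M T
  proof (rule ccontr)
    assume "\<not> ?thesis"
    then have MT: "real M * real T < n / 1000" by simp
    have "39 / 100 \<le> measure_pmf.prob (program_outcome n G0 G1 l P T) {(X, guess). guess \<noteq> X}"
      if "P \<in> set_pmf \<A>" for P
    proof (cases "M = 0")
      case True
      with that P have P0: "uses_space P 0" "queries_within P 0 {1..2 * n}" by auto
      show ?thesis
        unfolding prob_program_outcome[OF P0 finite_atLeastAtMost]
          expectation_memory_no_space[OF P0 finite_atLeastAtMost] by simp
    next
      case False
      \<comment> \<open>The constant 16 makes the exponent at least \<open>2 * ln n\<close>, so each
        answer is within \<open>2 / n\<close> of uniform despite the square root factor.\<close>
      have "\<phi>\<^sub>0\<^sup>2 * (16 / \<phi>\<^sub>0\<^sup>2 * ln n) \<le> \<phi>\<^sup>2 * l"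
        using assms \<phi> l n by (intro mult_mono power_mono) auto
      then have "exp (- (\<phi>\<^sup>2 * l / 8)) \<le> exp (- (2 * ln n))" using assms by simp
      also have "\<dots> = inverse ((exp (ln n))\<^sup>2)" by (simp only: exp_minus exp_double)
      also have "\<dots> = 1 / n\<^sup>2" using n by (simp add: inverse_eq_divide)
      finally have exp_le: "exp (- (\<phi>\<^sup>2 * l / 8)) \<le> 1 / n\<^sup>2" .
      have "2 * real n * 1 \<le> 2 * real n * (2 * real n)" using n by (intro mult_left_mono) auto
      then have "sqrt (2 * real n) \<le> 2 * n"
        by (intro real_le_lsqrt) (auto simp: power2_eq_square)
      then have "sqrt (2 * real n) * exp (- (\<phi>\<^sup>2 * l / 8)) \<le> (2 * n) * (1 / n\<^sup>2)"
        using exp_le by (intro mult_mono) auto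
      also have "\<dots> = 2 / n" using n by (simp add: power2_eq_square)
      finally have \<epsilon>: "sqrt (2 * real n) * exp (- (\<phi>\<^sup>2 * l / 8)) \<le> 2 / n" .
      \<comment> \<open>For \<open>M \<ge> 1\<close> the bound on \<open>M * T\<close> also bounds
        \<open>T\<close>, which controls the accumulated mixing error and the additive 1 beside
        \<open>4 * M * ln 2\<close>.\<close>
      have "real 1 * real T \<le> real M * real T" using False by (intro mult_right_mono) auto
      then have T: "real T \<le> real M * real T" by simp
      have "T * (1 + 4 * real M * ln 2) \<le> real T * (1 + 4 * real M * 1)"
        using ln_le_minus_one[of 2] by (intro mult_left_mono add_left_mono) auto
      also have "\<dots> \<le> 5 * (real M * real T)" using T by (simp add: algebra_simps)
      finally have "T * (1 + 4 * real M * ln 2) / (n * (1/6)) \<le> 30 / 1000"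
        using MT n by (simp add: field_simps)
      moreover have "2 * real T * (2 / n) \<le> 4 / 1000"
        using MT T n by (simp add: field_simps)
      \<comment> \<open>With \<open>\<delta> = 1/6\<close> and \<open>\<epsilon> = 2 / n\<close> the
        losses are at most 1/6, 30/1000 and 4/1000; half of what remains exceeds 39/100, which is
        above 1/3.\<close>
      ultimately have "39 / 100 \<le> (1 - 1/6 - T * (1 + 4 * real M * ln 2) / (n * (1/6)) - 2 * real T * (2 / n)) / 2"
        by simp
      also have "\<dots> \<le> measure_pmf.prob (program_outcome n G0 G1 l P T) {(X, guess). guess \<noteq> X}"
        using n d \<phi> G0 G1 P that \<epsilon> by (intro prob_program_outcome_ge) auto
      finally show ?thesis .
    qed
    then have "39 / 100 \<le> error_prob n G0 G1 l \<A> T"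
      unfolding error_prob_eq by (rule prob_bind_pmf_ge)
    with err show False by simp
  qed
  show ?thesis
  proof (rule exI[of _ "16 / \<phi>\<^sub>0\<^sup>2"], intro conjI allI impI)
    show "0 < 16 / \<phi>\<^sub>0\<^sup>2" using assms by simp
  qed (use main in \<open>intro exI[of _ "1/1000"] conjI exI[of _ 1] allI impI; auto\<close>)
qed

end
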